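(* Let $n\ge5$ and $\gamma\in(0,\pi)$, write $x=(x',x_n)\in\mathbb{R}^{n-1}\times\mathbb{R}$ and $\Delta'=\sum_{i=1}^{n-1}\frac{\partial^2}{\partial x_i^2}$. The fundamental solution $F_{n,\gamma}$ of $$L_\gamma=(\Delta')^2+2\cos\gamma\ \Delta'\left(\tfrac{\partial}{\partial x_n}\right)^2+\left(\tfrac{\partial}{\partial x_n}\right)^4$$ satisfies: (a) when $|x'|\neq0$ and $x_n\neq0$, $$F_{n,\gamma}(x)=\frac{1}{2^{n-2}\,\Gamma\left(\frac{n-2}{2}\right)\pi^{n/2}|x'|^{n-4}}\int_0^\infty C_n(s)\,\frac{\exp\left(-\frac{|x_n|}{|x'|}s\cos\left(\frac12\gamma\right)\right)\sin\left(\frac{|x_n|}{|x'|}s\sin\left(\frac12\gamma\right)+\frac12\gamma\right)}{2\sin(\gamma)}\,s^{n-5}\,ds,$$ where $C_n(s):=\int_0^\pi\cos(s\cos\varphi)\,(\sin\varphi)^{n-3}\,d\varphi$; (b) when $|x'|=0$ and $x_n\neq0$, $$F_{n,\gamma}(x)=\frac{\Gamma(n-4)}{2^{n-1}\,\Gamma\left(\frac{n-1}{2}\right)\pi^{(n-1)/2}|x_n|^{n-4}\sin(\gamma)}\,\sin\left(\frac{n-3}{2}\gamma\right).$$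
   Context: $F_{n,\gamma}$ denotes the fundamental solution of $L_\gamma$ on $\mathbb{R}^n$ with pole $0$, i.e. $L_\gamma F_{n,\gamma}=\delta_0$ in the sense of distributions, given by $F_{n,\gamma}=(2\pi)^{-n/2}\mathcal{F}^{-1}(1/Q_\gamma)$ as a tempered distribution, where $Q_\gamma(\xi',\xi_n)=|\xi'|^4+2\cos\gamma\,|\xi'|^2\xi_n^2+\xi_n^4$ and $\mathcal{F}u(\xi)=(2\pi)^{-n/2}\int_{\mathbb{R}^n}e^{-ix\cdot\xi}u(x)\,dx$. It is a regular distribution, i.e. a function, which is $C^\infty$ on $\mathbb{R}^n\setminus\{0\}$ and homogeneous of degree $4-n$ (and it is the unique fundamental solution of $L_\gamma$ with this homogeneity). $\Gamma$ is the Gamma function. *)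

theory Defs
  imports "HOL-Analysis.Analysis"
begin

section \<open>Smooth functions, test functions and Schwartz functions\<close>

text \<open>
  For a differentiable function, \<open>partial_deriv v f\<close> is the directional derivative along \<open>v\<close>;
  for \<open>v \<in> Basis\<close> this is an ordinary partial derivative.
\<close>

definition partial_deriv ::
    "'a::euclidean_space \<Rightarrow> ('a \<Rightarrow> 'b::real_normed_vector) \<Rightarrow> 'a \<Rightarrow> 'b" where
  "partial_deriv v f = (\<lambda>x. frechet_derivative f (at x) v)"

fun iter_partial ::
    "'a::euclidean_space list \<Rightarrow> ('a \<Rightarrow> 'b::real_normed_vector) \<Rightarrow> 'a \<Rightarrow> 'b" where
  "iter_partial [] f = f"
| "iter_partial (v # vs) f = partial_deriv v (iter_partial vs f)"

text \<open>
  \<open>C\<^sup>\<infinity>\<close> on an open set: the iterated partial derivatives of all orders exist and are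
  differentiable, hence continuous.
\<close>

definition smooth_on ::
    "'a::euclidean_space set \<Rightarrow> ('a \<Rightarrow> 'b::real_normed_vector) \<Rightarrow> bool" where
  "smooth_on S f \<longleftrightarrow> (\<forall>vs. set vs \<subseteq> Basis \<longrightarrow> iter_partial vs f differentiable_on S)"

definition test_function :: "('a::euclidean_space \<Rightarrow> complex) \<Rightarrow> bool" where
  "test_function \<phi> \<longleftrightarrow> smooth_on UNIV \<phi> \<and> compact (closure {x. \<phi> x \<noteq> 0})"

definition schwartz :: "('a::euclidean_space \<Rightarrow> complex) \<Rightarrow> bool" where
  "schwartz \<phi> \<longleftrightarrow> smooth_on UNIV \<phi> \<and>
     (\<forall>k::nat. \<forall>vs. set vs \<subseteq> Basis \<longrightarrow>
        bounded (range (\<lambda>x. norm x ^ k *\<^sub>R iter_partial vs \<phi> x)))"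


section \<open>Distributions and the Fourier transform\<close>

text \<open>
  Distributions are represented by functionals, of which only the values on test functions
  (respectively, on Schwartz functions for tempered distributions) are relevant.
\<close>

type_synonym 'a functional = "('a \<Rightarrow> complex) \<Rightarrow> complex"

definition regular_dist :: "('a::euclidean_space \<Rightarrow> complex) \<Rightarrow> 'a functional" where
  "regular_dist f = (\<lambda>\<phi>. LINT x|lborel. f x * \<phi> x)"

definition dirac0 :: "'a::euclidean_space functional" where
  "dirac0 = (\<lambda>\<phi>. \<phi> 0)"

text \<open>The pairing of \<open>f\<close> with every Schwartz function is an absolutely convergent integral.\<close>

definition tempered_function :: "('a::euclidean_space \<Rightarrow> complex) \<Rightarrow> bool" where
  "tempered_function f \<longleftrightarrow> (\<forall>\<phi>. schwartz \<phi> \<longrightarrow> integrable lborel (\<lambda>x. f x * \<phi> x))"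

text \<open>
  Inverse of the unitary Fourier transform
  \<open>\<F>u(\<xi>) = (2\<pi>)\<^bsup>-n/2\<^esup> \<integral> e\<^bsup>-i x \<bullet> \<xi>\<^esup> u(x) dx\<close>, extended to tempered distributions by duality:
  \<open>\<langle>\<F>\<^sup>-\<^sup>1 T, \<phi>\<rangle> = \<langle>T, \<F>\<^sup>-\<^sup>1 \<phi>\<rangle>\<close>.
\<close>

definition inv_fourier :: "('a::euclidean_space \<Rightarrow> complex) \<Rightarrow> 'a \<Rightarrow> complex" where
  "inv_fourier u = (\<lambda>x. complex_of_real ((2 * pi) powr (- real DIM('a) / 2)) *
     (LINT \<xi>|lborel. exp (\<i> * complex_of_real (x \<bullet> \<xi>)) * u \<xi>))"

definition dist_inv_fourier :: "'a::euclidean_space functional \<Rightarrow> 'a functional" where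
  "dist_inv_fourier T = (\<lambda>\<phi>. T (inv_fourier \<phi>))"


section \<open>The operator and its fundamental solution\<close>

text \<open>Points \<open>(x', x\<^sub>n)\<close> of \<open>\<real>\<^bsup>n-1\<^esup> \<times> \<real>\<close>, with \<open>n - 1 = CARD('m)\<close>.\<close>

type_synonym 'm point = "(real ^ 'm) \<times> real"

definition laplace' :: "('m::finite point \<Rightarrow> complex) \<Rightarrow> 'm point \<Rightarrow> complex" where
  "laplace' f = (\<lambda>x. \<Sum>i\<in>UNIV. partial_deriv (axis i 1, 0) (partial_deriv (axis i 1, 0) f) x)"

definition partial_n :: "('m::finite point \<Rightarrow> complex) \<Rightarrow> 'm point \<Rightarrow> complex" where
  "partial_n = partial_deriv (0, 1)"

definition L_op :: "real \<Rightarrow> ('m::finite point \<Rightarrow> complex) \<Rightarrow> 'm point \<Rightarrow> complex" where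
  "L_op \<gamma> f = (\<lambda>x. laplace' (laplace' f) x
      + complex_of_real (2 * cos \<gamma>) * laplace' (partial_n (partial_n f)) x
      + partial_n (partial_n (partial_n (partial_n f))) x)"

text \<open>
  The formal transpose of \<open>L_op \<gamma>\<close> is \<open>L_op \<gamma>\<close> itself, as all its terms are of even order with
  constant coefficients.
\<close>

definition L_dist :: "real \<Rightarrow> 'm::finite point functional \<Rightarrow> 'm point functional" where
  "L_dist \<gamma> T = (\<lambda>\<phi>. T (L_op \<gamma> \<phi>))"

definition Q_symbol :: "real \<Rightarrow> 'm::finite point \<Rightarrow> real" where
  "Q_symbol \<gamma> = (\<lambda>(\<xi>', \<xi>n). norm \<xi>' ^ 4 + 2 * cos \<gamma> * norm \<xi>' ^ 2 * \<xi>n ^ 2 + \<xi>n ^ 4)"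

text \<open>
  \<open>(2\<pi>)\<^bsup>-n/2\<^esup> \<F>\<^sup>-\<^sup>1(1/Q\<^sub>\<gamma>)\<close>; the value of \<open>1/Q\<^sub>\<gamma>\<close> at its singularity \<open>0\<close> is immaterial.
\<close>

definition fund_dist :: "real \<Rightarrow> 'm::finite point functional" where
  "fund_dist \<gamma> = (\<lambda>\<phi>. complex_of_real ((2 * pi) powr (- real DIM('m point) / 2)) *
     dist_inv_fourier (regular_dist (\<lambda>\<xi>. complex_of_real (1 / Q_symbol \<gamma> \<xi>))) \<phi>)"

text \<open>
  \<open>F\<close> is the function \<open>F\<^sub>n\<^sub>,\<^sub>\<gamma>\<close>. This determines \<open>F\<close> everywhere except at \<open>0\<close>, where its value is
  left open.
\<close>

definition is_fundamental_solution :: "real \<Rightarrow> ('m::finite point \<Rightarrow> complex) \<Rightarrow> bool" where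
  "is_fundamental_solution \<gamma> F \<longleftrightarrow>
     tempered_function F \<and>
     (\<forall>\<phi>. schwartz \<phi> \<longrightarrow> regular_dist F \<phi> = fund_dist \<gamma> \<phi>) \<and>
     (\<forall>\<phi>. test_function \<phi> \<longrightarrow> L_dist \<gamma> (regular_dist F) \<phi> = dirac0 \<phi>) \<and>
     smooth_on (- {0}) F \<and>
     (\<forall>t>0. \<forall>x. x \<noteq> 0 \<longrightarrow>
        F (t *\<^sub>R x) = complex_of_real (t powr (4 - real DIM('m point))) * F x)"

definition C_fun :: "nat \<Rightarrow> real \<Rightarrow> real" where
  "C_fun n s = (LBINT \<phi>:{0..pi}. cos (s * cos \<phi>) * sin \<phi> ^ (n - 3))"

end

theory Submission
  imports Defs "HOL-Probability.Characteristic_Functions" "HOL-Real_Asymp.Real_Asymp"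
begin

text \<open>
  Off its pole, \<open>F\<close> is continuous, so \<open>F(a)\<close> is the limit of the pairings of \<open>F\<close> with ever narrower
  normalised Gaussians centred at \<open>a\<close>; these are Schwartz functions with explicit Fourier transform.
  On the Fourier side the pairing is \<open>(2\<pi>)\<^sup>-\<^sup>n \<integral> e\<^bsup>i a \<bullet> \<xi>\<^esup> e\<^bsup>-|\<xi>|\<^sup>2/4b\<^esup> / Q(\<xi>) d\<xi>\<close>. For fixed \<open>\<xi>'\<close> the function
  \<open>1/Q(\<xi>', \<cdot>)\<close> is the Fourier transform of an explicit damped oscillation \<open>G(|\<xi>'|, \<cdot>)\<close>, so the
  \<open>\<xi>\<^sub>n\<close>-integral is a Gaussian mollification of \<open>G(|\<xi>'|, \<cdot>)\<close> at \<open>a\<^sub>n\<close>. The loss from mollifying the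
  exponential decay is at most \<open>2 e\<^bsup>|\<xi>'|\<^sup>2/4b\<^esup>\<close>, which the remaining Gaussian factor cancels; hence
  dominated convergence as \<open>b \<longlongrightarrow> \<infinity>\<close> for \<open>a\<^sub>n \<noteq> 0\<close>. What is left is the Fourier transform of a radial
  function of \<open>\<xi>'\<close>, evaluated in polar coordinates.
\<close>

section \<open>Gaussians as test functions\<close>

text \<open>A Gaussian factor splits over \<xi>' and \<xi>_n and over coordinates. The kernel G
  needs no contour integral. With w = r e^(-i \<gamma>/2) the symbol factors as (w^2 + t^2)(conj w^2
  + t^2), so its inverse transform combines e^(-w |y|) and e^(-conj w |y|); that combination is
  written down and its forward transform is computed. Two different facts make the final integral
  over \<xi>' converge: n - 1 \<ge> 4 tames the factor r^(-3) of G at the origin, and a_n \<noteq> 0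
  supplies the decay e^(-r |a_n| cos(\<gamma>/2)) at infinity. One Laplace integral with complex
  rate, that of t^k e^(-w t), serves both ends: k = 0 for the transform of G, k = n - 5 for the
  closed form on the axis. The function C_n appears because a plane wave sees a sphere of radius r
  only through one coordinate t = - r cos \<phi>.\<close>

lemma real_polynomial_function_derivative:
  fixes p :: "'a::euclidean_space \<Rightarrow> real"
  assumes "real_polynomial_function p"
  shows "\<exists>D. (\<forall>x. (p has_derivative D x) (at x)) \<and> (\<forall>v. real_polynomial_function (\<lambda>x. D x v))"
  using assms
proof (induction p rule: real_polynomial_function.induct)
  case (linear f)
  then show ?case
    by (intro exI[of _ "\<lambda>x. f"]) (auto intro: bounded_linear.has_derivative has_derivative_ident bounded_linear_imp_has_derivative)
next
  case (const c)
  then show ?case by (intro exI[of _ "\<lambda>x v. 0"]) auto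
next
  case (add f g)
  then obtain D E where "\<forall>x. (f has_derivative D x) (at x)" "\<forall>v. real_polynomial_function (\<lambda>x. D x v)"
    "\<forall>x. (g has_derivative E x) (at x)" "\<forall>v. real_polynomial_function (\<lambda>x. E x v)" by blast
  then show ?case
    by (intro exI[of _ "\<lambda>x v. D x v + E x v"]) (auto intro: has_derivative_add real_polynomial_function.intros)
next
  case (mult f g)
  then obtain D E where D: "\<forall>x. (f has_derivative D x) (at x)" "\<forall>v. real_polynomial_function (\<lambda>x. D x v)"
    and E: "\<forall>x. (g has_derivative E x) (at x)" "\<forall>v. real_polynomial_function (\<lambda>x. E x v)" by blast
  show ?case
  proof (intro exI[of _ "\<lambda>x v. f x * E x v + D x v * g x"] conjI allI)
    fix x show "((\<lambda>x. f x * g x) has_derivative (\<lambda>v. f x * E x v + D x v * g x)) (at x)"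
      using has_derivative_mult D(1) E(1) by blast
    fix v show "real_polynomial_function (\<lambda>x. f x * E x v + D x v * g x)"
      by (intro real_polynomial_function.intros(3,4) mult.hyps D(2)[rule_format] E(2)[rule_format])
  qed
qed

lemma real_polynomial_function_growth:
  fixes p :: "'a::euclidean_space \<Rightarrow> real"
  assumes "real_polynomial_function p"
  shows "\<exists>C N. \<forall>x. \<bar>p x\<bar> \<le> C * (1 + norm x) ^ N"
  using assms
proof (induction p rule: real_polynomial_function.induct)
  case (linear f)
  then obtain K where K: "\<And>x. norm (f x) \<le> norm x * K" "K > 0"
    using bounded_linear.pos_bounded by blast
  have "\<bar>f x\<bar> \<le> K * (1 + norm x) ^ 1" for x
  proof -
    have "\<bar>f x\<bar> \<le> norm x * K" using K(1)[of x] by simp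
    also have "\<dots> \<le> K * (1 + norm x) ^ 1" using K(2) by (simp add: algebra_simps)
    finally show ?thesis .
  qed
  then show ?case by blast
next
  case (const c)
  then show ?case by (intro exI[of _ "\<bar>c\<bar>"] exI[of _ 0]) auto
next
  case (add f g)
  then obtain C M D N where *: "\<And>x. \<bar>f x\<bar> \<le> C * (1 + norm x) ^ M" "\<And>x. \<bar>g x\<bar> \<le> D * (1 + norm x) ^ N"
    by blast
  have "\<bar>f x + g x\<bar> \<le> (\<bar>C\<bar> + \<bar>D\<bar>) * (1 + norm x) ^ (M + N)" for x
  proof -
    have "C * (1 + norm x) ^ M \<le> \<bar>C\<bar> * (1 + norm x) ^ (M + N)"
      by (intro mult_mono power_increasing) auto
    moreover have "D * (1 + norm x) ^ N \<le> \<bar>D\<bar> * (1 + norm x) ^ (M + N)"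
      by (intro mult_mono power_increasing) auto
    ultimately show ?thesis using *[of x] abs_triangle_ineq[of "f x" "g x"] by (simp add: distrib_right)
  qed
  then show ?case by blast
next
  case (mult f g)
  then obtain C M D N where *: "\<And>x. \<bar>f x\<bar> \<le> C * (1 + norm x) ^ M" "\<And>x. \<bar>g x\<bar> \<le> D * (1 + norm x) ^ N"
    by blast
  have "\<bar>f x * g x\<bar> \<le> (C * D) * (1 + norm x) ^ (M + N)" for x
  proof -
    have "\<bar>f x\<bar> * \<bar>g x\<bar> \<le> (C * (1 + norm x) ^ M) * (D * (1 + norm x) ^ N)"
      by (rule mult_mono) (use *[of x] in auto)
    then show ?thesis by (simp add: abs_mult power_add mult_ac)
  qed
  then show ?case by blast
qed

lemma power_le_fact_exp:
  fixes x :: real assumes "0 \<le> x" shows "x ^ n \<le> fact n * exp x"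
proof -
  have "(\<Sum>k\<in>{n}. x ^ k /\<^sub>R fact k) \<le> (\<Sum>k. x ^ k /\<^sub>R fact k)"
    using assms by (intro sum_le_suminf summable_exp_generic) auto
  then show ?thesis by (simp add: exp_def field_simps)
qed

text \<open>Differentiating the exponent contributes the polynomial factor - 2 b (x - a) \<bullet>
  v, so polynomials times a fixed Gaussian are closed under partial derivatives. Iterated partials
  then need not be computed: \<open>schwartz_gaussian\<close> only uses that some polynomial
  exists.\<close>

lemma partial_deriv_polynomial_gaussian:
  fixes p :: "'a::euclidean_space \<Rightarrow> real"
  assumes "real_polynomial_function p"
  shows "\<exists>q. real_polynomial_function q \<and>
    partial_deriv v (\<lambda>x. complex_of_real (p x * exp (- b * (norm (x - a))\<^sup>2))) =
      (\<lambda>x. complex_of_real (q x * exp (- b * (norm (x - a))\<^sup>2)))"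
    and "(\<lambda>x. complex_of_real (p x * exp (- b * (norm (x - a))\<^sup>2))) differentiable_on UNIV"
proof -
  obtain D where D: "\<And>x. (p has_derivative D x) (at x)" "\<And>v. real_polynomial_function (\<lambda>x. D x v)"
    using real_polynomial_function_derivative[OF assms] by blast
  have der: "((\<lambda>x. complex_of_real (p x * exp (- b * (norm (x - a))\<^sup>2))) has_derivative
     (\<lambda>v. complex_of_real ((D x v + p x * (- 2 * b * (inner (x - a) v))) * exp (- b * (norm (x - a))\<^sup>2)))) (at x)" for x
    unfolding power2_norm_eq_inner
    by (rule derivative_eq_intros D refl | simp add: algebra_simps inner_commute)+
  then show "(\<lambda>x. complex_of_real (p x * exp (- b * (norm (x - a))\<^sup>2))) differentiable_on UNIV"
    by (auto simp: differentiable_on_def differentiable_def)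
  have lin: "real_polynomial_function (\<lambda>x. inner (x - a) v)"
    by (simp only: inner_diff_left, rule real_polynomial_function_diff)
       (auto intro: real_polynomial_function.intros bounded_linear_inner_left)
  have "real_polynomial_function (\<lambda>x. D x v + p x * (- 2 * b * (inner (x - a) v)))"
    by (intro real_polynomial_function.intros(2-4) D assms lin)
  then show "\<exists>q. real_polynomial_function q \<and>
    partial_deriv v (\<lambda>x. complex_of_real (p x * exp (- b * (norm (x - a))\<^sup>2))) =
      (\<lambda>x. complex_of_real (q x * exp (- b * (norm (x - a))\<^sup>2)))"
    unfolding partial_deriv_def frechet_derivative_at[OF der, symmetric] by blast
qed

lemma bounded_polynomial_gaussian:
  fixes p :: "'a::euclidean_space \<Rightarrow> real"
  assumes "real_polynomial_function p" "0 < b"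
  shows "bounded (range (\<lambda>x. norm x ^ k *\<^sub>R complex_of_real (p x * exp (- b * (norm (x - a))\<^sup>2))))"
proof -
  obtain C N where CN: "\<And>x. \<bar>p x\<bar> \<le> C * (1 + norm x) ^ N"
    using real_polynomial_function_growth[OF assms(1)] by blast
  have "0 \<le> C" using CN[of 0] by simp
  define M where "M = k + N"
  have "norm (norm x ^ k *\<^sub>R complex_of_real (p x * exp (- b * (norm (x - a))\<^sup>2)))
      \<le> C * (1 + norm a) ^ M * (fact M / b ^ M * exp (2 * b))" for x
  proof -
    define t where "t = norm (x - a)"
    have "norm x \<le> t + norm a" "0 \<le> norm a * t"
      using norm_triangle_ineq[of "x - a" a] by (simp_all add: t_def)
    moreover have "(1 + norm a) * (1 + t) = 1 + norm a + t + norm a * t" by (simp add: algebra_simps)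
    ultimately have t: "1 + norm x \<le> (1 + norm a) * (1 + t)" by linarith
    have "(b * (1 + t)) ^ M \<le> fact M * exp (b * (1 + t))"
      using assms(2) by (intro power_le_fact_exp) (auto simp: t_def)
    then have "(1 + t) ^ M \<le> fact M / b ^ M * exp (b * (1 + t))"
      using assms(2) unfolding power_mult_distrib by (simp add: pos_le_divide_eq mult.commute)
    \<comment> \<open>Expanding the square gives the tangent line bound - b t^2 \<le> b - 2 b t. Its
      slope is twice that of the exponent b (1 + t) bounding the power, so the product still
      decays.\<close>
    moreover have "0 \<le> b * (t - 1)\<^sup>2" using assms(2) by simp
    then have "exp (- b * t\<^sup>2) \<le> exp (b - b * (2 * t))"
      by (simp add: power2_eq_square algebra_simps)
    ultimately have "(1 + t) ^ M * exp (- b * t\<^sup>2) \<le> (fact M / b ^ M * exp (b * (1 + t))) * exp (b - b * (2 * t))"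
      using assms(2) by (intro mult_mono) (auto simp: t_def)
    also have "\<dots> = fact M / b ^ M * exp (2 * b - b * t)"
      by (simp add: exp_add[symmetric] algebra_simps)
    also have "\<dots> \<le> fact M / b ^ M * exp (2 * b)"
      using assms(2) by (intro mult_left_mono) (auto simp: t_def)
    finally have 1: "(1 + t) ^ M * exp (- b * t\<^sup>2) \<le> fact M / b ^ M * exp (2 * b)" .
    have "norm x ^ k * \<bar>p x\<bar> \<le> (1 + norm x) ^ k * (C * (1 + norm x) ^ N)"
      by (intro mult_mono power_mono CN) auto
    also have "\<dots> = C * (1 + norm x) ^ M" by (simp add: M_def power_add)
    also have "\<dots> \<le> C * ((1 + norm a) * (1 + t)) ^ M"
      using t \<open>0 \<le> C\<close> by (intro mult_left_mono power_mono) auto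
    finally have "norm x ^ k * \<bar>p x\<bar> * exp (- b * t\<^sup>2) \<le> C * ((1 + norm a) * (1 + t)) ^ M * exp (- b * t\<^sup>2)"
      by (intro mult_right_mono) auto
    also have "\<dots> = C * (1 + norm a) ^ M * ((1 + t) ^ M * exp (- b * t\<^sup>2))"
      by (simp add: power_mult_distrib)
    also have "\<dots> \<le> C * (1 + norm a) ^ M * (fact M / b ^ M * exp (2 * b))"
      using \<open>0 \<le> C\<close> by (intro mult_left_mono 1) auto
    finally show ?thesis by (simp add: t_def norm_mult abs_mult)
  qed
  then show ?thesis by (auto intro!: boundedI)
qed

lemma schwartz_gaussian:
  fixes a :: "'a::euclidean_space"
  assumes "0 < b"
  shows "schwartz (\<lambda>x. complex_of_real (c * exp (- b * (norm (x - a))\<^sup>2)))"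
proof -
  have *: "\<exists>p. real_polynomial_function p \<and>
    iter_partial vs (\<lambda>x. complex_of_real (c * exp (- b * (norm (x - a))\<^sup>2))) =
      (\<lambda>x. complex_of_real (p x * exp (- b * (norm (x - a))\<^sup>2)))" for vs
  proof (induction vs)
    case Nil
    show ?case by (intro exI[of _ "\<lambda>x. c"]) (auto intro: real_polynomial_function.intros)
  next
    case (Cons v vs)
    then show ?case using partial_deriv_polynomial_gaussian(1)[of _ v b a] by fastforce
  qed
  have "iter_partial vs (\<lambda>x. complex_of_real (c * exp (- b * (norm (x - a))\<^sup>2))) differentiable_on UNIV \<and>
    bounded (range (\<lambda>x. norm x ^ k *\<^sub>R iter_partial vs (\<lambda>x. complex_of_real (c * exp (- b * (norm (x - a))\<^sup>2))) x))" for vs k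
  proof -
    obtain p where p: "real_polynomial_function p"
      "iter_partial vs (\<lambda>x. complex_of_real (c * exp (- b * (norm (x - a))\<^sup>2))) =
      (\<lambda>x. complex_of_real (p x * exp (- b * (norm (x - a))\<^sup>2)))" using * by blast
    show ?thesis
      unfolding p(2) using partial_deriv_polynomial_gaussian(2)[OF p(1)] bounded_polynomial_gaussian[OF p(1) assms]
      by blast
  qed
  then show ?thesis
    unfolding schwartz_def smooth_on_def by blast
qed

section \<open>Fourier transform of Gaussians and approximate identities\<close>

text \<open>Density of the normal law with mean a and variance 1/(2b) in each coordinate; large b
  means narrow.\<close>

definition gaussian :: "real \<Rightarrow> 'a::euclidean_space \<Rightarrow> 'a \<Rightarrow> real" where
  "gaussian b a x = (b / pi) powr (DIM('a) / 2) * exp (- b * (norm (x - a))\<^sup>2)"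

lemma gaussian_nonneg [simp]: "0 \<le> gaussian b a x"
  by (simp add: gaussian_def)

lemma continuous_on_gaussian [continuous_intros]: "continuous_on S (gaussian b a)"
  unfolding gaussian_def by (intro continuous_intros)

lemma borel_measurable_gaussian [measurable]: "gaussian b a \<in> borel_measurable borel"
  by (intro borel_measurable_continuous_onI continuous_intros)

lemma gaussian_real_eq_normal_density:
  assumes "0 < b"
  shows "gaussian b (a::real) x = normal_density a (1 / sqrt (2 * b)) x"
proof -
  have "(1 / sqrt (2 * b))\<^sup>2 = 1 / (2 * b)" using assms by (simp add: power_divide)
  moreover have "1 / sqrt (2 * pi * (1 / (2 * b))) = sqrt (b / pi)" using assms by (simp add: real_sqrt_divide)
  moreover have "- (x - a)\<^sup>2 / (2 * (1 / (2 * b))) = - b * (x - a)\<^sup>2" using assms by simp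
  ultimately show ?thesis using assms by (simp add: gaussian_def normal_density_def powr_half_sqrt)
qed

lemma gaussian_prod:
  fixes a :: "'a::euclidean_space"
  assumes "0 < b"
  shows "gaussian b a x = (\<Prod>i\<in>Basis. gaussian b (a \<bullet> i) (x \<bullet> i))"
proof -
  have "(norm (x - a))\<^sup>2 = (\<Sum>i\<in>Basis. (x \<bullet> i - a \<bullet> i)\<^sup>2)"
    unfolding power2_norm_eq_inner euclidean_inner[of "x - a" "x - a"] by (simp add: inner_diff_left power2_eq_square)
  moreover have "((b / pi) powr (1/2)) ^ DIM('a) = (b / pi) powr (DIM('a) / 2)"
    using assms by (simp add: powr_power)
  ultimately show ?thesis
    by (simp add: gaussian_def prod.distrib exp_sum[symmetric] sum_distrib_left sum_negf)
qed

text \<open>An affine substitution with scale 1 / sqrt (2 b) reduces the transform to the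
  characteristic function of the standard normal law.\<close>

lemma gaussian_real_char:
  assumes "0 < b"
  shows "integrable lborel (gaussian b (a::real))"
    and "(LINT x|lborel. iexp (t * x) * complex_of_real (gaussian b a x)) =
       iexp (t * a) * complex_of_real (exp (- t\<^sup>2 / (4 * b)))"
proof -
  let ?s = "1 / sqrt (2 * b)"
  have s: "0 < ?s" using assms by simp
  show int: "integrable lborel (gaussian b a)"
    using integrable_normal_density[OF s, of a] gaussian_real_eq_normal_density[OF assms, of a] by presburger
  have "(LINT x|lborel. iexp (t * x) * complex_of_real (gaussian b a x)) =
    \<bar>?s\<bar> *\<^sub>R (LINT x|lborel. iexp (t * (a + ?s * x)) * complex_of_real (gaussian b a (a + ?s * x)))"
    using s by (intro lborel_integral_real_affine[where f = "\<lambda>x. iexp (t * x) * complex_of_real (gaussian b a x)"]) simp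
  also have "\<dots> = (LINT x|lborel. iexp (t * a) * (std_normal_density x *\<^sub>R iexp ((t * ?s) * x)))"
    unfolding integral_scaleR_right[symmetric]
  proof (intro Bochner_Integration.integral_cong refl)
    fix x
    have "?s * gaussian b a (a + ?s * x) = std_normal_density x"
    proof -
      have "?s * sqrt (b / pi) = 1 / sqrt (2 * pi)"
        using assms by (simp add: real_sqrt_divide real_sqrt_mult)
      moreover have "- b * (?s * x)\<^sup>2 = - x\<^sup>2 / 2"
        using assms by (simp add: power_mult_distrib power_divide)
      moreover have "?s * gaussian b a (a + ?s * x) = (?s * sqrt (b / pi)) * exp (- b * (?s * x)\<^sup>2)"
        using assms by (simp add: gaussian_def powr_half_sqrt power_divide)
      ultimately show ?thesis by (simp only: std_normal_density_def)
    qed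
    then show "\<bar>?s\<bar> *\<^sub>R (iexp (t * (a + ?s * x)) * complex_of_real (gaussian b a (a + ?s * x))) =
       iexp (t * a) * (std_normal_density x *\<^sub>R iexp ((t * ?s) * x))"
    proof -
      have "iexp (t * (a + ?s * x)) = iexp (t * a) * iexp ((t * ?s) * x)"
        unfolding exp_add[symmetric] by (simp add: distrib_left mult.assoc)
      then show ?thesis
        unfolding \<open>?s * gaussian b a (a + ?s * x) = std_normal_density x\<close>[symmetric] using s
        by (simp add: scaleR_conv_of_real)
    qed
  qed
  also have "\<dots> = iexp (t * a) * (LINT x|lborel. (std_normal_density x *\<^sub>R iexp ((t * ?s) * x)))"
    by (rule integral_mult_right_zero)
  also have "(LINT x|lborel. (std_normal_density x *\<^sub>R iexp ((t * ?s) * x))) = char std_normal_distribution (t * ?s)"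
    unfolding char_def by (subst integral_density) auto
  also have "\<dots> = complex_of_real (exp (- t\<^sup>2 / (4 * b)))"
    using assms by (simp add: char_std_normal_distribution power_mult_distrib power_divide)
  finally show "(LINT x|lborel. iexp (t * x) * complex_of_real (gaussian b a x)) =
       iexp (t * a) * complex_of_real (exp (- t\<^sup>2 / (4 * b)))" .
qed

text \<open>Squared norm and inner product are sums over coordinates, and \<open>lborel\<close> is
  the image of a product of one-dimensional measures, so the integral is a product of
  one-dimensional transforms.\<close>

lemma gaussian_char:
  fixes a \<xi> :: "'a::euclidean_space"
  assumes "0 < b"
  shows "integrable lborel (gaussian b a)"
    and "(LINT x|lborel. iexp (x \<bullet> \<xi>) * complex_of_real (gaussian b a x)) =
       iexp (a \<bullet> \<xi>) * complex_of_real (exp (- (norm \<xi>)\<^sup>2 / (4 * b)))"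
proof -
  interpret product_sigma_finite "\<lambda>_::'a. lborel :: real measure" by standard
  define h where "h i t = iexp ((\<xi> \<bullet> i) * t) * complex_of_real (gaussian b (a \<bullet> i) t)" for i :: 'a and t
  have h: "iexp (x \<bullet> \<xi>) * complex_of_real (gaussian b a x) = (\<Prod>i\<in>Basis. h i (x \<bullet> i))" for x
  proof -
    have "iexp (x \<bullet> \<xi>) = (\<Prod>i\<in>Basis. iexp ((\<xi> \<bullet> i) * (x \<bullet> i)))"
      by (simp add: euclidean_inner[of x \<xi>] sum_distrib_left exp_sum mult.commute)
    then show ?thesis
      by (simp add: h_def prod.distrib gaussian_prod[OF assms, of a x])
  qed
  have int_h: "integrable lborel (h i)" for i
  proof (rule Bochner_Integration.integrable_bound[OF gaussian_real_char(1)[OF assms, of "a \<bullet> i"]])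
    show "h i \<in> borel_measurable lborel" unfolding h_def by measurable
  qed (simp add: h_def norm_mult gaussian_nonneg)
  have coord: "(\<Sum>b\<in>Basis. f b *\<^sub>R b) \<bullet> i = f i" if "i \<in> Basis" for f and i :: 'a
    using that by simp
  have "integrable (Pi\<^sub>M Basis (\<lambda>_. lborel)) (\<lambda>x. \<Prod>i\<in>Basis. h i (x i))"
    by (intro product_integrable_prod int_h finite_Basis)
  then have "integrable lborel (\<lambda>x. \<Prod>i\<in>Basis. h i (x \<bullet> i))"
    unfolding lborel_eq[where 'a='a] by (subst integrable_distr_eq) (auto simp: h_def)
  then have "integrable lborel (\<lambda>x. norm (iexp (x \<bullet> \<xi>) * complex_of_real (gaussian b a x)))"
    unfolding h by (rule integrable_norm)
  then show "integrable lborel (gaussian b a)"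
    by (simp add: norm_mult gaussian_nonneg)
  have "(LINT x|lborel. iexp (x \<bullet> \<xi>) * complex_of_real (gaussian b a x)) =
      (LINT x|(Pi\<^sub>M Basis (\<lambda>_. lborel)). (\<Prod>i\<in>Basis. h i (x i)))"
    unfolding h lborel_eq[where 'a='a] by (subst integral_distr) (auto simp: h_def)
  also have "\<dots> = (\<Prod>i\<in>Basis. LINT t|lborel. h i t)"
    by (intro product_integral_prod int_h finite_Basis)
  also have "\<dots> = (\<Prod>i\<in>Basis. iexp ((\<xi> \<bullet> i) * (a \<bullet> i)) * complex_of_real (exp (- (\<xi> \<bullet> i)\<^sup>2 / (4 * b))))"
    unfolding h_def by (simp only: gaussian_real_char(2)[OF assms])
  also have "\<dots> = iexp (a \<bullet> \<xi>) * complex_of_real (exp (- (norm \<xi>)\<^sup>2 / (4 * b)))"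
  proof -
    have "iexp (a \<bullet> \<xi>) = (\<Prod>i\<in>Basis. iexp ((\<xi> \<bullet> i) * (a \<bullet> i)))"
      by (simp add: euclidean_inner[of a \<xi>] sum_distrib_left exp_sum mult.commute)
    moreover have "(norm \<xi>)\<^sup>2 = (\<Sum>i\<in>Basis. (\<xi> \<bullet> i)\<^sup>2)"
      unfolding power2_norm_eq_inner euclidean_inner[of \<xi> \<xi>] by (simp add: power2_eq_square)
    then have "exp (- (norm \<xi>)\<^sup>2 / (4 * b)) = (\<Prod>i\<in>Basis. exp (- (\<xi> \<bullet> i)\<^sup>2 / (4 * b)))"
      by (simp add: exp_sum[symmetric] sum_negf sum_divide_distrib)
    ultimately show ?thesis by (simp add: prod.distrib)
  qed
  finally show "(LINT x|lborel. iexp (x \<bullet> \<xi>) * complex_of_real (gaussian b a x)) =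
       iexp (a \<bullet> \<xi>) * complex_of_real (exp (- (norm \<xi>)\<^sup>2 / (4 * b)))" .
qed

lemma gaussian_integral:
  fixes a :: "'a::euclidean_space"
  assumes "0 < b"
  shows "(LINT x|lborel. gaussian b a x) = 1"
proof -
  have "complex_of_real (LINT x|lborel. gaussian b a x) = 1"
    using gaussian_char(2)[OF assms, where a = a and \<xi> = 0] by simp
  then show ?thesis by simp
qed

text \<open>F may be singular away from a, as the fundamental solution is at 0; hence only
  continuity at a and integrability against one fixed Gaussian are asked. Away from a, a narrow
  Gaussian is at most a vanishing constant times that fixed one.\<close>

lemma gaussian_approximate_identity:
  fixes F :: "'a::euclidean_space \<Rightarrow> complex"
  assumes int: "integrable lborel (\<lambda>x. F x * complex_of_real (exp (- (norm (x - a))\<^sup>2)))"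
    and cont: "isCont F a"
  shows "(\<lambda>j. LINT x|lborel. F x * complex_of_real (gaussian (real (Suc j)) a x)) \<longlonglongrightarrow> F a"
proof (rule LIMSEQ_I)
  fix \<eta> :: real assume "0 < \<eta>"
  define E where "E x = exp (- (norm (x - a))\<^sup>2)" for x
  have E_pos: "0 < E x" for x by (simp add: E_def)
  have intE: "integrable lborel E"
  proof -
    have "E = (\<lambda>x. (1 / pi) powr (- (DIM('a) / 2)) * gaussian 1 a x)"
      unfolding gaussian_def E_def by (simp add: powr_minus flip: mult.assoc)
    then show ?thesis
      using gaussian_char(1)[of 1 a] by (simp only: integrable_mult_right)
  qed
  have [measurable]: "E \<in> borel_measurable borel"
    unfolding E_def by (intro borel_measurable_continuous_onI continuous_intros)
  have intF: "integrable lborel (\<lambda>x. F x * complex_of_real (E x))" using int by (simp add: E_def)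
  \<comment> \<open>Measurability of F is recovered by dividing the integrable product by its
    positive factor \<open>E\<close>.\<close>
  have [measurable]: "F \<in> borel_measurable borel"
  proof -
    have E0: "E x \<noteq> 0" for x using E_pos[of x] by simp
    have [measurable]: "(\<lambda>x. F x * complex_of_real (E x)) \<in> borel_measurable borel"
      using borel_measurable_integrable[OF intF] by simp
    have "(\<lambda>x. F x * complex_of_real (E x) / complex_of_real (E x)) \<in> borel_measurable borel"
      by measurable
    then show ?thesis by (simp add: E0)
  qed
  obtain \<rho> where "0 < \<rho>" and \<rho>: "\<And>x. norm (x - a) < \<rho> \<Longrightarrow> norm (F x - F a) < \<eta> / 2"
    using cont \<open>0 < \<eta>\<close> unfolding continuous_at_eps_delta dist_norm by (meson half_gt_zero)
  define I where "I = (LINT x|lborel. norm (F x - F a) * E x)"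
  \<comment> \<open>Of the \<open>Suc j\<close> factors exp (- |x - a|^2), one is kept as
    \<open>E x\<close> for integrability; the other j are together at most exp (- j \<rho>^2)
    outside the ball of radius \<rho>, which beats the normalising power of
    \<open>Suc j\<close>.\<close>
  define c where "c j = (real (Suc j) / pi) powr (DIM('a) / 2) * exp (- (real j * \<rho>\<^sup>2))" for j
  have c: "c j \<ge> 0" for j by (simp add: c_def)
  have intd: "integrable lborel (\<lambda>x. norm (F x - F a) * E x)"
  proof -
    have "integrable lborel (\<lambda>x. F x * complex_of_real (E x) - F a * complex_of_real (E x))"
      using intF intE by (intro Bochner_Integration.integrable_diff integrable_mult_right integrable_of_real)
    then have "integrable lborel (\<lambda>x. norm (F x * complex_of_real (E x) - F a * complex_of_real (E x)))"
      by (rule integrable_norm)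
    then show ?thesis
      using E_pos by (simp add: norm_mult less_imp_le flip: left_diff_distrib)
  qed
  have pt: "norm (F x - F a) * gaussian (real (Suc j)) a x \<le>
      \<eta> / 2 * gaussian (real (Suc j)) a x + c j * (norm (F x - F a) * E x)" for x j
  proof (cases "norm (x - a) < \<rho>")
    case True
    then have "norm (F x - F a) * gaussian (real (Suc j)) a x \<le> \<eta> / 2 * gaussian (real (Suc j)) a x"
      using \<rho> by (intro mult_right_mono gaussian_nonneg) (simp add: less_imp_le)
    moreover have "0 \<le> c j * (norm (F x - F a) * E x)"
      using c E_pos[of x] by simp
    ultimately show ?thesis by linarith
  next
    case False
    have "real j * \<rho>\<^sup>2 \<le> real j * (norm (x - a))\<^sup>2"
      using False \<open>0 < \<rho>\<close> by (intro mult_left_mono power_mono) auto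
    then have "exp (- (real (Suc j) * (norm (x - a))\<^sup>2)) \<le> exp (- (real j * \<rho>\<^sup>2)) * E x"
      by (simp add: E_def algebra_simps flip: exp_add)
    then have "gaussian (real (Suc j)) a x \<le> c j * E x"
      unfolding gaussian_def c_def mult.assoc mult_minus_left by (intro mult_left_mono) simp_all
    then have "norm (F x - F a) * gaussian (real (Suc j)) a x \<le> norm (F x - F a) * (c j * E x)"
      by (intro mult_left_mono) auto
    moreover have "0 \<le> \<eta> / 2 * gaussian (real (Suc j)) a x"
      using \<open>0 < \<eta>\<close> gaussian_nonneg by (intro mult_nonneg_nonneg) auto
    ultimately show ?thesis by (simp add: mult_ac)
  qed
  have int_g: "integrable lborel (gaussian (real (Suc j)) a)" for j
    by (rule gaussian_char) simp
  have int_Fg: "integrable lborel (\<lambda>x. norm (F x - F a) * gaussian (real (Suc j)) a x)" for j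
  proof (rule Bochner_Integration.integrable_bound)
    show "integrable lborel (\<lambda>x. \<eta> / 2 * gaussian (real (Suc j)) a x + c j * (norm (F x - F a) * E x))"
      using int_g intd by (intro Bochner_Integration.integrable_add integrable_mult_right)
    show "AE x in lborel. norm (norm (F x - F a) * gaussian (real (Suc j)) a x)
         \<le> norm (\<eta> / 2 * gaussian (real (Suc j)) a x + c j * (norm (F x - F a) * E x))"
    proof (rule AE_I2)
      fix x
      have "norm (norm (F x - F a) * gaussian (real (Suc j)) a x) = norm (F x - F a) * gaussian (real (Suc j)) a x"
        unfolding real_norm_def by (intro abs_of_nonneg mult_nonneg_nonneg norm_ge_zero gaussian_nonneg)
      also note pt
      also have "\<eta> / 2 * gaussian (real (Suc j)) a x + c j * (norm (F x - F a) * E x) \<le>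
          norm (\<eta> / 2 * gaussian (real (Suc j)) a x + c j * (norm (F x - F a) * E x))"
        unfolding real_norm_def by (rule abs_ge_self)
      finally show "norm (norm (F x - F a) * gaussian (real (Suc j)) a x)
         \<le> norm (\<eta> / 2 * gaussian (real (Suc j)) a x + c j * (norm (F x - F a) * E x))" .
    qed
  qed measurable
  have est: "norm ((LINT x|lborel. F x * complex_of_real (gaussian (real (Suc j)) a x)) - F a) \<le> \<eta> / 2 + c j * I" for j
  proof -
    let ?g = "gaussian (real (Suc j)) a"
    have 1: "integrable lborel (\<lambda>x. (F x - F a) * complex_of_real (?g x))"
    proof -
      have "norm ((F x - F a) * complex_of_real (?g x)) = norm (F x - F a) * ?g x" for x
        using gaussian_nonneg by (simp add: norm_mult)
      then have "integrable lborel (\<lambda>x. norm ((F x - F a) * complex_of_real (?g x)))"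
        using int_Fg by presburger
      then show ?thesis
        by (rule integrable_norm_cancel) measurable
    qed
    have 2: "integrable lborel (\<lambda>x. F a * complex_of_real (?g x))"
      using int_g by (intro integrable_mult_right integrable_of_real)
    have "(LINT x|lborel. F x * complex_of_real (?g x)) =
        (LINT x|lborel. (F x - F a) * complex_of_real (?g x) + F a * complex_of_real (?g x))"
      by (simp add: algebra_simps)
    also have "\<dots> = (LINT x|lborel. (F x - F a) * complex_of_real (?g x)) + F a"
      using gaussian_integral[of "real (Suc j)" a] Bochner_Integration.integral_add[OF 1 2] by simp
    finally have "norm ((LINT x|lborel. F x * complex_of_real (?g x)) - F a) =
       norm (LINT x|lborel. (F x - F a) * complex_of_real (?g x))" by simp
    also have "\<dots> \<le> (LINT x|lborel. norm ((F x - F a) * complex_of_real (?g x)))"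
      by (rule integral_norm_bound)
    also have "\<dots> = (LINT x|lborel. norm (F x - F a) * ?g x)"
      using gaussian_nonneg by (simp add: norm_mult)
    also have "\<dots> \<le> (LINT x|lborel. \<eta> / 2 * ?g x + c j * (norm (F x - F a) * E x))"
      using int_g intd int_Fg pt
      by (intro integral_mono Bochner_Integration.integrable_add integrable_mult_right)
    also have "\<dots> = (LINT x|lborel. \<eta> / 2 * ?g x) + (LINT x|lborel. c j * (norm (F x - F a) * E x))"
      using int_g intd by (intro Bochner_Integration.integral_add integrable_mult_right)
    also have "\<dots> = \<eta> / 2 + c j * I"
      using gaussian_integral[of "real (Suc j)" a] by (simp add: I_def)
    finally show ?thesis .
  qed
  have "c \<longlonglongrightarrow> 0"
  proof -
    define R where "R = \<rho>\<^sup>2"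
    define d where "d = real DIM('a) / 2"
    have "0 < R" using \<open>0 < \<rho>\<close> by (simp add: R_def)
    then have "(\<lambda>j. (real (Suc j) / pi) powr d * exp (- (real j * R))) \<longlonglongrightarrow> 0"
      by real_asymp
    then show ?thesis by (simp add: c_def[abs_def] R_def d_def)
  qed
  then have "(\<lambda>j. c j * I) \<longlonglongrightarrow> 0" by (rule tendsto_mult_left_zero)
  then have "\<forall>\<^sub>F j in sequentially. c j * I < \<eta> / 2"
    using \<open>0 < \<eta>\<close> by (intro order_tendstoD) auto
  then obtain N where N: "\<And>j. j \<ge> N \<Longrightarrow> c j * I < \<eta> / 2"
    by (auto simp: eventually_sequentially)
  have "norm ((LINT x|lborel. F x * complex_of_real (gaussian (real (Suc j)) a x)) - F a) < \<eta>" if "j \<ge> N" for j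
    using est[of j] N[OF that] by linarith
  then show "\<exists>N. \<forall>j\<ge>N. norm ((LINT x|lborel. F x * complex_of_real (gaussian (real (Suc j)) a x)) - F a) < \<eta>"
    by blast
qed

lemma inv_fourier_gaussian:
  fixes a :: "'a::euclidean_space"
  assumes "0 < b"
  shows "inv_fourier (\<lambda>x. complex_of_real (gaussian b a x)) =
    (\<lambda>\<xi>. complex_of_real ((2 * pi) powr (- real DIM('a) / 2) * exp (- (norm \<xi>)\<^sup>2 / (4 * b))) * iexp (a \<bullet> \<xi>))"
  unfolding inv_fourier_def using gaussian_char(2)[OF assms, where a = a]
  by (simp add: inner_commute mult_ac)

section \<open>The one-dimensional symbol\<close>

lemma set_integrable_exp_neg:
  fixes a :: real assumes "0 < a"
  shows "set_integrable lborel {0<..} (\<lambda>t. exp (- a * t))"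
proof -
  have "integrable lborel (\<lambda>t::real. t ^ 0 * exp (- t) * indicator {0..} t)"
  proof (rule integrableI_nn_integral_finite)
    show "(\<integral>\<^sup>+t. ennreal (t ^ 0 * exp (- t) * indicator {0..} t) \<partial>lborel) = ennreal (fact 0)"
      using nn_intergal_power_times_exp_Ici[of 0] by (simp add: ennreal_mult'' ennreal_indicator)
  qed (auto simp: indicator_def)
  from lborel_integrable_real_affine[OF this, of a 0]
  have "integrable lborel (\<lambda>t::real. exp (- (a * t)) * indicator {0..} (a * t))" using assms by simp
  then have "integrable lborel (\<lambda>t::real. indicator {0<..} t *\<^sub>R (exp (- (a * t)) * indicator {0..} (a * t)))"
    by (intro integrable_mult_indicator) auto
  also have "(\<lambda>t::real. indicator {0<..} t *\<^sub>R (exp (- (a * t)) * indicator {0..} (a * t))) =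
      (\<lambda>t. indicator {0<..} t *\<^sub>R exp (- a * t))"
    using assms by (auto simp: indicator_def fun_eq_iff)
  finally show ?thesis by (simp add: set_integrable_def)
qed

lemma set_integrable_power_exp_neg:
  fixes w :: complex assumes "0 < Re w"
  shows "set_integrable lborel {0<..} (\<lambda>t. complex_of_real t ^ k * exp (- w * complex_of_real t))"
proof (rule set_integrable_bound)
  \<comment> \<open>Half of the decay rate absorbs the power \<open>t ^ k\<close>; the other half
    stays integrable.\<close>
  let ?c = "Re w / 2"
  show "set_integrable lborel {0<..} (\<lambda>t. fact k / ?c ^ k * exp (- ?c * t))"
    using set_integrable_exp_neg[of ?c] assms by simp
  show "set_borel_measurable lborel {0<..} (\<lambda>t. complex_of_real t ^ k * exp (- w * complex_of_real t))"
    unfolding set_borel_measurable_def by measurable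
  have "norm (complex_of_real t ^ k * exp (- w * complex_of_real t)) \<le> norm (fact k / ?c ^ k * exp (- ?c * t))" if "t \<in> {0<..}" for t
  proof -
    have "(?c * t) ^ k \<le> fact k * exp (?c * t)"
      using that assms by (intro power_le_fact_exp) simp
    then have "t ^ k \<le> fact k / ?c ^ k * exp (?c * t)"
      using assms unfolding power_mult_distrib by (simp add: pos_le_divide_eq mult.commute)
    then have "t ^ k * exp (- Re w * t) \<le> fact k / ?c ^ k * exp (?c * t) * exp (- Re w * t)"
      by (intro mult_right_mono) auto
    also have "\<dots> = fact k / ?c ^ k * exp (- ?c * t)"
      by (simp add: mult.assoc exp_add[symmetric])
    finally show ?thesis
      using that assms by (simp add: norm_mult norm_power)
  qed
  then show "AE t in lborel. t \<in> {0<..} \<longrightarrow> norm (complex_of_real t ^ k * exp (- w * complex_of_real t)) \<le> norm (fact k / ?c ^ k * exp (- ?c * t))"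
    by simp
qed

lemma tendsto_power_exp_neg:
  fixes w :: complex assumes "0 < Re w"
  shows "((\<lambda>t. complex_of_real t ^ k * exp (- w * complex_of_real t)) \<longlongrightarrow> 0) at_top"
proof (rule tendsto_norm_zero_cancel)
  define c where "c = Re w"
  have "0 < c" using assms by (simp add: c_def)
  then have "((\<lambda>t. t ^ k * exp (- c * t)) \<longlongrightarrow> 0) at_top" by real_asymp
  moreover have "\<forall>\<^sub>F t in at_top. t ^ k * exp (- c * t) = norm (complex_of_real t ^ k * exp (- w * complex_of_real t))"
    using eventually_ge_at_top[of 0] by eventually_elim (simp add: norm_mult norm_power c_def)
  ultimately show "((\<lambda>t. norm (complex_of_real t ^ k * exp (- w * complex_of_real t))) \<longlongrightarrow> 0) at_top"
    by (rule Lim_transform_eventually)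
qed

lemma integral_Ioi_FTC:
  fixes F f :: "real \<Rightarrow> complex"
  assumes "\<And>t. (F has_vector_derivative f t) (at t)" "\<And>t. isCont f t" "set_integrable lborel {0<..} f"
    and "(F \<longlongrightarrow> 0) at_top"
  shows "(LBINT t:{0<..}. f t) = - F 0"
proof -
  have "(LBINT t=0..\<infinity>. f t) = 0 - F 0"
  proof (rule interval_integral_FTC_integrable[where F = F])
    show "((F \<circ> real_of_ereal) \<longlongrightarrow> F 0) (at_right 0)"
    proof -
      have "isCont F 0" using assms(1)[of 0] by (rule has_vector_derivative_continuous)
      then have "(F \<longlongrightarrow> F 0) (at_right 0)" by (auto simp: isCont_def filterlim_at_split)
      then show ?thesis unfolding zero_ereal_def by (simp only: ereal_tendsto_simps)
    qed
    show "((F \<circ> real_of_ereal) \<longlongrightarrow> 0) (at_left \<infinity>)"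
      using assms(4) by (simp only: ereal_tendsto_simps)
    show "set_integrable lborel (einterval 0 \<infinity>) f"
      using assms(3) by (simp add: zero_ereal_def)
  qed (use assms in auto)
  then show ?thesis by (simp add: interval_integral_to_infinity_eq zero_ereal_def)
qed

text \<open>Integration by parts as an induction: the boundary term - t^(k+1) e^(-w t) / w vanishes
  at both ends. Admitting complex w makes rotations of the contour unnecessary.\<close>

lemma integral_power_exp_neg:
  fixes w :: complex assumes "0 < Re w"
  shows "(LBINT t:{0<..}. complex_of_real t ^ k * exp (- w * complex_of_real t)) = fact k / w ^ Suc k"
proof (induction k)
  case 0
  have w: "w \<noteq> 0" using assms by auto
  have "(LBINT t:{0<..}. complex_of_real t ^ 0 * exp (- w * complex_of_real t)) = - (- exp (- w * complex_of_real 0) / w)"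
  proof (rule integral_Ioi_FTC)
    show "((\<lambda>t. - exp (- w * complex_of_real t) / w) has_vector_derivative complex_of_real t ^ 0 * exp (- w * complex_of_real t)) (at t)" for t
      using w by (auto intro!: derivative_eq_intros has_vector_derivative_real_field simp: field_simps)
    show "((\<lambda>t. - exp (- w * complex_of_real t) / w) \<longlongrightarrow> 0) at_top"
      using tendsto_divide[OF tendsto_minus[OF tendsto_power_exp_neg[OF assms, of 0]] tendsto_const, of w] w by simp
  qed (use set_integrable_power_exp_neg[OF assms, of 0] in \<open>auto intro!: continuous_intros\<close>)
  then show ?case by simp
next
  case (Suc k)
  have w: "w \<noteq> 0" using assms by auto
  let ?e = "\<lambda>k t. complex_of_real t ^ k * exp (- w * complex_of_real t)"
  have int: "set_integrable lborel {0<..} (?e (Suc k))" "set_integrable lborel {0<..} (\<lambda>t. of_nat (Suc k) / w * ?e k t)"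
    using set_integrable_power_exp_neg[OF assms] by (auto simp del: power_Suc intro!: set_integrable_mult_right)
  have "(LBINT t:{0<..}. ?e (Suc k) t - of_nat (Suc k) / w * ?e k t) = - (- ?e (Suc k) 0 / w)"
  proof (rule integral_Ioi_FTC)
    show "((\<lambda>t. - ?e (Suc k) t / w) has_vector_derivative ?e (Suc k) t - of_nat (Suc k) / w * ?e k t) (at t)" for t
    proof (rule has_vector_derivative_real_field)
      fix z :: complex
      have "((\<lambda>z. z ^ Suc k) has_field_derivative of_nat (Suc k) * z ^ k) (at z)"
        using DERIV_power[OF DERIV_ident, where n = "Suc k" and x = z and s = UNIV] by (simp del: power_Suc)
      moreover have "((\<lambda>z. exp (- w * z)) has_field_derivative - w * exp (- w * z)) (at z)"
        by (auto intro!: derivative_eq_intros)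
      ultimately have "((\<lambda>z. z ^ Suc k * exp (- w * z)) has_field_derivative
          of_nat (Suc k) * z ^ k * exp (- w * z) + - w * exp (- w * z) * z ^ Suc k) (at z)"
        by (rule DERIV_mult)
      from DERIV_cdivide[OF DERIV_minus[OF this], of w]
      show "((\<lambda>z. - (z ^ Suc k * exp (- w * z)) / w) has_field_derivative
          z ^ Suc k * exp (- w * z) - of_nat (Suc k) / w * (z ^ k * exp (- w * z))) (at z)"
        by (rule DERIV_cong) (use w in \<open>simp add: field_simps\<close>)
    qed
    show "((\<lambda>t. - ?e (Suc k) t / w) \<longlongrightarrow> 0) at_top"
      using tendsto_divide[OF tendsto_minus[OF tendsto_power_exp_neg[OF assms, of "Suc k"]] tendsto_const, of w] w by simp
    show "set_integrable lborel {0<..} (\<lambda>t. ?e (Suc k) t - of_nat (Suc k) / w * ?e k t)"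
      using int by (rule set_integral_diff)
  qed (use w in \<open>auto intro!: continuous_intros\<close>)
  then have "(LBINT t:{0<..}. ?e (Suc k) t) = of_nat (Suc k) / w * (LBINT t:{0<..}. ?e k t)"
    using set_integral_diff(2)[OF int] by simp
  also have "\<dots> = fact (Suc k) / w ^ Suc (Suc k)" unfolding Suc.IH by (simp add: field_simps)
  finally show ?case .
qed

section \<open>The slice kernel and its Fourier transform\<close>

text \<open>The function \<open>G(r, \<cdot>)\<close>, i.e. the inverse Fourier transform of \<open>1/Q\<close> in \<open>\<xi>\<^sub>n\<close> alone, at \<open>|\<xi>'| = r\<close>.\<close>

definition slice_kernel :: "real \<Rightarrow> real \<Rightarrow> real \<Rightarrow> real" where
  "slice_kernel \<gamma> r y =
     exp (- (r * \<bar>y\<bar> * cos (\<gamma> / 2))) * sin (r * \<bar>y\<bar> * sin (\<gamma> / 2) + \<gamma> / 2) / (2 * r ^ 3 * sin \<gamma>)"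

lemma slice_kernel_minus [simp]: "slice_kernel \<gamma> r (- y) = slice_kernel \<gamma> r y"
  by (simp add: slice_kernel_def)

lemma borel_measurable_slice_kernel [measurable]: "slice_kernel \<gamma> r \<in> borel_measurable borel"
  unfolding slice_kernel_def by measurable

lemma cos_half_pos:
  assumes "0 < \<gamma>" "\<gamma> < pi" shows "0 < cos (\<gamma> / 2)" "0 < sin \<gamma>"
  using assms by (auto intro: cos_gt_zero sin_gt_zero)

text \<open>The damped sine is the imaginary part of a complex exponential, hence a difference of
  two conjugate exponentials with rates w and conj w, to which \<open>integral_power_exp_neg\<close>
  applies. The points +-i w and +-i conj w are the zeros of the symbol in \<xi>_n.\<close>

lemma slice_kernel_cis:
  assumes "0 < \<gamma>" "\<gamma> < pi" "0 < r" "0 < y"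
  defines "w \<equiv> complex_of_real r * cis (- (\<gamma> / 2))"
  shows "complex_of_real (slice_kernel \<gamma> r y) =
    (cis (\<gamma> / 2) * exp (- w * complex_of_real y) - cis (- (\<gamma> / 2)) * exp (- cnj w * complex_of_real y)) /
      (4 * \<i> * complex_of_real (r ^ 3 * sin \<gamma>))"
proof -
  define z where "z = cis (\<gamma> / 2) * exp (- w * complex_of_real y)"
  have "- w * complex_of_real y = complex_of_real (- (r * y * cos (\<gamma> / 2))) + \<i> * complex_of_real (r * y * sin (\<gamma> / 2))"
    by (simp add: w_def complex_eq_iff)
  then have "z = complex_of_real (exp (- (r * y * cos (\<gamma> / 2)))) * cis (r * y * sin (\<gamma> / 2) + \<gamma> / 2)"
    unfolding z_def by (simp only: exp_add exp_of_real cis_conv_exp[symmetric] cis_mult[symmetric] mult_ac)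
  then have "Im z = exp (- (r * y * cos (\<gamma> / 2))) * sin (r * y * sin (\<gamma> / 2) + \<gamma> / 2)"
    by simp
  then have "slice_kernel \<gamma> r y = Im z / (2 * r ^ 3 * sin \<gamma>)"
    using assms by (simp add: slice_kernel_def)
  moreover have "cnj z = cis (- (\<gamma> / 2)) * exp (- cnj w * complex_of_real y)"
    by (simp add: z_def cis_cnj exp_cnj)
  moreover have "z - cnj z = 2 * \<i> * complex_of_real (Im z)"
    by (simp add: complex_eq_iff)
  ultimately show ?thesis
    unfolding z_def[symmetric] by simp
qed

lemma abs_slice_kernel_le:
  assumes "0 < \<gamma>" "\<gamma> < pi" "0 < r"
  shows "\<bar>slice_kernel \<gamma> r y\<bar> \<le> exp (- (r * \<bar>y\<bar> * cos (\<gamma> / 2))) / (2 * r ^ 3 * sin \<gamma>)"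
  using assms cos_half_pos[OF assms(1,2)]
  by (simp add: slice_kernel_def abs_mult divide_right_mono mult_left_le)

text \<open>The kernel depends on |y|, so its exponential form is smooth only on each half-line;
  reflection brings the negative half to the same form as the positive one.\<close>

lemma integral_symmetric_halves:
  fixes g :: "real \<Rightarrow> complex"
  assumes "set_integrable lborel {0<..} g" "set_integrable lborel {0<..} (\<lambda>y. g (- y))"
    and [measurable]: "g \<in> borel_measurable borel"
  shows "integrable lborel g"
    and "(LINT y|lborel. g y) = (LBINT y:{0<..}. g y) + (LBINT y:{0<..}. g (- y))"
proof -
  let ?p = "\<lambda>y. indicator {0<..} y *\<^sub>R g y" and ?n = "\<lambda>y. indicator {..<0} y *\<^sub>R g y"
  have n: "(\<lambda>y::real. ?n (0 + (- 1) * y)) = (\<lambda>y. indicator {0<..} y *\<^sub>R g (- y))"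
    by (auto simp: indicator_def)
  have int_p: "integrable lborel ?p" using assms(1) by (simp add: set_integrable_def)
  have int_n: "integrable lborel ?n"
    using lborel_integrable_real_affine_iff[of "- 1" ?n 0] assms(2) unfolding n by (simp add: set_integrable_def)
  have AE: "AE y in lborel. ?p y + ?n y = g y"
    using AE_lborel_singleton[of 0] by eventually_elim (auto simp: indicator_def)
  have sum: "integrable lborel (\<lambda>y. ?p y + ?n y)"
    using int_p int_n by (rule Bochner_Integration.integrable_add)
  then show "integrable lborel g" by (rule integrable_cong_AE_imp) (use AE in auto)
  have "(LINT y|lborel. g y) = (LINT y|lborel. ?p y + ?n y)"
    by (rule integral_cong_AE) (use AE in auto)
  also have "\<dots> = (LINT y|lborel. ?p y) + (LINT y|lborel. ?n y)"
    using int_p int_n by (rule Bochner_Integration.integral_add)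
  also have "(LINT y|lborel. ?n y) = (LINT y|lborel. indicator {0<..} y *\<^sub>R g (- y))"
    using lborel_integral_real_affine[of "- 1" ?n 0] unfolding n by simp
  finally show "(LINT y|lborel. g y) = (LBINT y:{0<..}. g y) + (LBINT y:{0<..}. g (- y))"
    by (simp add: set_lebesgue_integral_def)
qed

text \<open>Ellipticity on a slice: completing the square leaves 2 (1 + cos \<gamma>) r^2 \<xi>^2,
  and 1 + cos \<gamma> > 0 because \<gamma> stays below pi.\<close>

lemma slice_symbol_pos:
  fixes r \<xi> :: real
  assumes "0 < \<gamma>" "\<gamma> < pi" "0 < r"
  shows "0 < r ^ 4 + 2 * cos \<gamma> * r\<^sup>2 * \<xi>\<^sup>2 + \<xi> ^ 4"
proof -
  have "-1 < cos \<gamma>" using cos_monotone_0_pi[of \<gamma> pi] assms by simp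
  have "r ^ 4 + 2 * cos \<gamma> * r\<^sup>2 * \<xi>\<^sup>2 + \<xi> ^ 4 = (r\<^sup>2 - \<xi>\<^sup>2)\<^sup>2 + 2 * (1 + cos \<gamma>) * (r\<^sup>2 * \<xi>\<^sup>2)"
    by (simp add: power2_eq_square power4_eq_xxxx algebra_simps)
  moreover have "0 < (r\<^sup>2 - \<xi>\<^sup>2)\<^sup>2 + 2 * (1 + cos \<gamma>) * (r\<^sup>2 * \<xi>\<^sup>2)"
  proof (cases "\<xi> = 0")
    case True
    then show ?thesis using assms by simp
  next
    case False
    then have "0 < 2 * (1 + cos \<gamma>) * (r\<^sup>2 * \<xi>\<^sup>2)" using assms \<open>-1 < cos \<gamma>\<close> by simp
    then show ?thesis by (simp add: add_nonneg_pos)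
  qed
  ultimately show ?thesis by simp
qed

text \<open>Computed forwards, from the kernel to the symbol: each half-line contributes two Laplace
  integrals, and the four resulting fractions recombine into the reciprocal of the symbol.\<close>

lemma fourier_slice_kernel:
  assumes "0 < \<gamma>" "\<gamma> < pi" "0 < r"
  shows "integrable lborel (\<lambda>y. iexp (- (\<xi> * y)) * complex_of_real (slice_kernel \<gamma> r y))"
    and "(LINT y|lborel. iexp (- (\<xi> * y)) * complex_of_real (slice_kernel \<gamma> r y)) =
      complex_of_real (1 / (r ^ 4 + 2 * cos \<gamma> * r\<^sup>2 * \<xi>\<^sup>2 + \<xi> ^ 4))"
proof -
  define w where "w = complex_of_real r * cis (- (\<gamma> / 2))"
  define c where "c = cis (\<gamma> / 2)"
  define K where "K = 1 / (4 * \<i> * complex_of_real (r ^ 3 * sin \<gamma>))"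
  note pos = cos_half_pos[OF assms(1,2)]
  have Re: "0 < Re (w + \<i> * complex_of_real s)" "0 < Re (cnj w + \<i> * complex_of_real s)" for s
    using pos assms by (auto simp: w_def)
  \<comment> \<open>The factor \<open>complex_of_real y ^ 0\<close> makes both terms literal
    instances of the Laplace integral with k = 0. The parameter s will be \<xi> on the positive
    half-line and - \<xi> on the reflected negative one.\<close>
  define g where "g s y = K * c * (complex_of_real y ^ 0 * exp (- (w + \<i> * complex_of_real s) * complex_of_real y)) -
      K * cnj c * (complex_of_real y ^ 0 * exp (- (cnj w + \<i> * complex_of_real s) * complex_of_real y))" for s y
  have g: "iexp (- (s * y)) * complex_of_real (slice_kernel \<gamma> r y) = g s y" if "0 < y" for s y
  proof -
    have "exp (- (v + \<i> * complex_of_real s) * complex_of_real y) = iexp (- (s * y)) * exp (- v * complex_of_real y)" for v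
      unfolding exp_add[symmetric] by (simp add: algebra_simps)
    then show ?thesis
      unfolding slice_kernel_cis[OF assms that] g_def w_def[symmetric] c_def K_def
      by (simp add: cis_cnj diff_divide_distrib algebra_simps)
  qed
  have int1: "set_integrable lborel {0<..} (\<lambda>y. v * (complex_of_real y ^ 0 * exp (- u * complex_of_real y)))"
    if "0 < Re u" for u v
    using set_integrable_power_exp_neg[OF that] by (rule set_integrable_mult_right)
  have g_int: "set_integrable lborel {0<..} (g s)"
    and g_val: "(LBINT y:{0<..}. g s y) = K * c / (w + \<i> * complex_of_real s) - K * cnj c / (cnj w + \<i> * complex_of_real s)" for s
    unfolding g_def using set_integral_diff[OF int1[OF Re(1)[of s], of "K * c"] int1[OF Re(2)[of s], of "K * cnj c"]]
    unfolding set_integral_mult_right integral_power_exp_neg[OF Re(1)] integral_power_exp_neg[OF Re(2)]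
    by simp_all
  let ?h = "\<lambda>y. iexp (- (\<xi> * y)) * complex_of_real (slice_kernel \<gamma> r y)"
  have h_pos: "?h y = g \<xi> y" and h_neg: "?h (- y) = g (- \<xi>) y" if "y \<in> {0<..}" for y
    using g[of y \<xi>] g[of y "- \<xi>"] that by simp_all
  have set1: "set_integrable lborel {0<..} ?h" "(LBINT y:{0<..}. ?h y) = (LBINT y:{0<..}. g \<xi> y)"
    using g_int[of \<xi>] set_integrable_cong[of lborel lborel "{0<..}" "{0<..}" ?h "g \<xi>"] set_lebesgue_integral_cong[of "{0<..}" lborel ?h "g \<xi>"] h_pos
    by simp_all
  have set2: "set_integrable lborel {0<..} (\<lambda>y. ?h (- y))" "(LBINT y:{0<..}. ?h (- y)) = (LBINT y:{0<..}. g (- \<xi>) y)"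
    using g_int[of "- \<xi>"] set_integrable_cong[of lborel lborel "{0<..}" "{0<..}" "\<lambda>y. ?h (- y)" "g (- \<xi>)"] set_lebesgue_integral_cong[of "{0<..}" lborel "\<lambda>y. ?h (- y)" "g (- \<xi>)"] h_neg
    by simp_all
  have h_meas: "?h \<in> borel_measurable borel" by measurable
  show "integrable lborel ?h"
    by (rule integral_symmetric_halves(1)[OF set1(1) set2(1) h_meas])
  define D where "D = r ^ 4 + 2 * cos \<gamma> * r\<^sup>2 * \<xi>\<^sup>2 + \<xi> ^ 4"
  have D: "0 < D" unfolding D_def by (rule slice_symbol_pos[OF assms])
  define x where "x = complex_of_real \<xi>"
  have nz: "w + \<i> * x \<noteq> 0" "w - \<i> * x \<noteq> 0" "cnj w + \<i> * x \<noteq> 0" "cnj w - \<i> * x \<noteq> 0"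
  proof -
    have "u \<noteq> 0" if "0 < Re u" for u :: complex using that by auto
    note * = this[OF Re(1)[of \<xi>]] this[OF Re(1)[of "- \<xi>"]] this[OF Re(2)[of \<xi>]] this[OF Re(2)[of "- \<xi>"]]
    show "w + \<i> * x \<noteq> 0" "w - \<i> * x \<noteq> 0" "cnj w + \<i> * x \<noteq> 0" "cnj w - \<i> * x \<noteq> 0"
      using * by (simp_all add: x_def)
  qed
  \<comment> \<open>The phase \<gamma>/2 inside the sine is what makes both numerators the same real
    number r once fractions with opposite signs of x are added.\<close>
  have cw: "c * w = complex_of_real r" "cnj c * cnj w = complex_of_real r"
    by (simp_all add: c_def w_def cis_cnj cis_mult)
  have w2: "w\<^sup>2 = complex_of_real (r\<^sup>2) * cis (- \<gamma>)" "(cnj w)\<^sup>2 = complex_of_real (r\<^sup>2) * cis \<gamma>"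
    by (simp_all add: w_def power_mult_distrib power2_eq_square cis_cnj cis_mult)
  have partial: "a / (u + \<i> * x) + a / (u - \<i> * x) = 2 * (a * u) / (u\<^sup>2 + x\<^sup>2)"
    if "u + \<i> * x \<noteq> 0" "u - \<i> * x \<noteq> 0" for a u
  proof -
    have "(u + \<i> * x) * (u - \<i> * x) = u\<^sup>2 + x\<^sup>2" by (simp add: power2_eq_square algebra_simps)
    then show ?thesis using that by (simp add: add_frac_eq algebra_simps)
  qed
  \<comment> \<open>Factorisation of the symbol over the complex numbers: its coefficients come from
    |w| = r and Re (w^2) = r^2 cos \<gamma>.\<close>
  have prod: "(w\<^sup>2 + x\<^sup>2) * ((cnj w)\<^sup>2 + x\<^sup>2) = complex_of_real D"
  proof -
    have "w\<^sup>2 * (cnj w)\<^sup>2 = complex_of_real (r ^ 4) * (cis (- \<gamma>) * cis \<gamma>)"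
      unfolding w2 by (simp add: power2_eq_square power4_eq_xxxx)
    moreover have "w\<^sup>2 + (cnj w)\<^sup>2 = complex_of_real (2 * cos \<gamma> * r\<^sup>2)"
      unfolding w2 by (simp add: complex_eq_iff)
    moreover have "(w\<^sup>2 + x\<^sup>2) * ((cnj w)\<^sup>2 + x\<^sup>2) = w\<^sup>2 * (cnj w)\<^sup>2 + (w\<^sup>2 + (cnj w)\<^sup>2) * x\<^sup>2 + x ^ 4"
      by (simp add: algebra_simps power2_eq_square power4_eq_xxxx)
    ultimately show ?thesis by (simp add: D_def x_def cis_mult)
  qed
  then have nz2: "w\<^sup>2 + x\<^sup>2 \<noteq> 0" "(cnj w)\<^sup>2 + x\<^sup>2 \<noteq> 0" using D by auto
  have diff: "(cnj w)\<^sup>2 - w\<^sup>2 = 2 * \<i> * complex_of_real (r\<^sup>2 * sin \<gamma>)"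
    unfolding w2 by (simp add: complex_eq_iff)
  have "(LINT y|lborel. ?h y) = (LBINT y:{0<..}. g \<xi> y) + (LBINT y:{0<..}. g (- \<xi>) y)"
    using integral_symmetric_halves(2)[OF set1(1) set2(1) h_meas] set1(2) set2(2) by simp
  also have "\<dots> = K * ((c / (w + \<i> * x) + c / (w - \<i> * x)) - (cnj c / (cnj w + \<i> * x) + cnj c / (cnj w - \<i> * x)))"
    unfolding g_val x_def by (simp add: algebra_simps)
  also have "\<dots> = K * (2 * complex_of_real r * (((cnj w)\<^sup>2 - w\<^sup>2) / complex_of_real D))"
    unfolding partial[OF nz(1,2)] partial[OF nz(3,4)] cw prod[symmetric]
    using nz2 by (simp add: diff_frac_eq algebra_simps)
  also have "\<dots> = complex_of_real (1 / D)"
    unfolding diff K_def using assms pos D by (simp add: field_simps power2_eq_square power3_eq_cube)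
  finally show "(LINT y|lborel. ?h y) = complex_of_real (1 / (r ^ 4 + 2 * cos \<gamma> * r\<^sup>2 * \<xi>\<^sup>2 + \<xi> ^ 4))"
    by (simp add: D_def)
qed

section \<open>Gaussian mollification of the slice kernel\<close>

definition slice_mollified :: "real \<Rightarrow> real \<Rightarrow> real \<Rightarrow> real \<Rightarrow> real" where
  "slice_mollified \<gamma> b r y0 = (LINT y|lborel. slice_kernel \<gamma> r y * gaussian b y0 y)"

text \<open>Completing the square moves the centre to y0 + s / (2 b) and leaves the constant s^2 /
  (4 b): the moment generating function of a normal law.\<close>

lemma integral_exp_gaussian:
  fixes s y0 :: real
  assumes "0 < b"
  shows "integrable lborel (\<lambda>y. exp (s * (y - y0)) * gaussian b y0 y)"
    and "(LINT y|lborel. exp (s * (y - y0)) * gaussian b y0 y) = exp (s\<^sup>2 / (4 * b))"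
proof -
  have eq: "exp (s * (y - y0)) * gaussian b y0 y = exp (s\<^sup>2 / (4 * b)) * gaussian b (y0 + s / (2 * b)) y" for y
  proof -
    have "s * (y - y0) + - b * (y - y0)\<^sup>2 = s\<^sup>2 / (4 * b) + - b * (y - (y0 + s / (2 * b)))\<^sup>2"
      using assms by (simp add: field_simps power2_eq_square)
    then have "exp (s * (y - y0)) * exp (- b * (y - y0)\<^sup>2) = exp (s\<^sup>2 / (4 * b)) * exp (- b * (y - (y0 + s / (2 * b)))\<^sup>2)"
      unfolding exp_add[symmetric] by simp
    then show ?thesis by (simp add: gaussian_def mult_ac)
  qed
  show "integrable lborel (\<lambda>y. exp (s * (y - y0)) * gaussian b y0 y)"
    unfolding eq using gaussian_real_char(1)[OF assms] by (rule integrable_mult_right)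
  show "(LINT y|lborel. exp (s * (y - y0)) * gaussian b y0 y) = exp (s\<^sup>2 / (4 * b))"
    unfolding eq using gaussian_integral[OF assms, of "y0 + s / (2 * b)"] by simp
qed

lemma abs_slice_kernel_le_const:
  assumes \<gamma>: "0 < \<gamma>" "\<gamma> < pi" and pos: "0 < r" shows "\<bar>slice_kernel \<gamma> r y\<bar> \<le> 1 / (2 * r ^ 3 * sin \<gamma>)"
proof -
  have "exp (- (r * \<bar>y\<bar> * cos (\<gamma> / 2))) \<le> 1"
    using cos_half_pos[OF \<gamma>] pos by simp
  then have "exp (- (r * \<bar>y\<bar> * cos (\<gamma> / 2))) / (2 * r ^ 3 * sin \<gamma>) \<le> 1 / (2 * r ^ 3 * sin \<gamma>)"
    using cos_half_pos[OF \<gamma>] pos by (intro divide_right_mono) auto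
  then show ?thesis using abs_slice_kernel_le[OF \<gamma> pos, of y] by linarith
qed

lemma integrable_slice_mollified:
  assumes \<gamma>: "0 < \<gamma>" "\<gamma> < pi" and pos: "0 < r" "0 < b"
  shows "integrable lborel (\<lambda>y. slice_kernel \<gamma> r y * gaussian b y0 y)"
proof (rule Bochner_Integration.integrable_bound)
  show "integrable lborel (\<lambda>y. 1 / (2 * r ^ 3 * sin \<gamma>) * gaussian b y0 y)"
    using gaussian_real_char(1)[OF pos(2)] by (rule integrable_mult_right)
  show "AE y in lborel. norm (slice_kernel \<gamma> r y * gaussian b y0 y) \<le> norm (1 / (2 * r ^ 3 * sin \<gamma>) * gaussian b y0 y)"
  proof (rule AE_I2)
    fix y
    have "\<bar>slice_kernel \<gamma> r y\<bar> * gaussian b y0 y \<le> 1 / (2 * r ^ 3 * sin \<gamma>) * gaussian b y0 y"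
      by (intro mult_right_mono abs_slice_kernel_le_const \<gamma> pos) simp
    also have "\<dots> \<le> \<bar>1 / (2 * r ^ 3 * sin \<gamma>) * gaussian b y0 y\<bar>" by (rule abs_ge_self)
    finally show "norm (slice_kernel \<gamma> r y * gaussian b y0 y) \<le> norm (1 / (2 * r ^ 3 * sin \<gamma>) * gaussian b y0 y)"
      unfolding real_norm_def abs_mult[of "slice_kernel \<gamma> r y"] abs_of_nonneg[OF gaussian_nonneg] .
  qed
qed measurable

text \<open>The kernel is bounded and the Gaussian has mass 1. This bound is the one applied at y0 =
  0, where it yields the absolute integrability behind
  \<open>gaussian_fourier_symbol\<close>.\<close>

lemma abs_slice_mollified_le:
  assumes \<gamma>: "0 < \<gamma>" "\<gamma> < pi" and pos: "0 < r" "0 < b"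
  shows "\<bar>slice_mollified \<gamma> b r y0\<bar> \<le> 1 / (2 * r ^ 3 * sin \<gamma>)"
proof -
  have "\<bar>slice_mollified \<gamma> b r y0\<bar> \<le> (LINT y|lborel. \<bar>slice_kernel \<gamma> r y * gaussian b y0 y\<bar>)"
    unfolding slice_mollified_def by (rule integral_abs_bound)
  also have "\<dots> \<le> (LINT y|lborel. 1 / (2 * r ^ 3 * sin \<gamma>) * gaussian b y0 y)"
  proof (rule integral_mono)
    show "integrable lborel (\<lambda>y. \<bar>slice_kernel \<gamma> r y * gaussian b y0 y\<bar>)"
      using integrable_slice_mollified[OF \<gamma> pos] by (rule integrable_abs)
    show "integrable lborel (\<lambda>y. 1 / (2 * r ^ 3 * sin \<gamma>) * gaussian b y0 y)"
      using gaussian_real_char(1)[OF pos(2)] by (rule integrable_mult_right)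
    show "\<bar>slice_kernel \<gamma> r y * gaussian b y0 y\<bar> \<le> 1 / (2 * r ^ 3 * sin \<gamma>) * gaussian b y0 y" for y
      unfolding abs_mult abs_of_nonneg[OF gaussian_nonneg]
      by (intro mult_right_mono abs_slice_kernel_le_const \<gamma> pos gaussian_nonneg)
  qed
  also have "\<dots> = 1 / (2 * r ^ 3 * sin \<gamma>)"
    using gaussian_integral[OF pos(2), of y0] by simp
  finally show ?thesis .
qed

text \<open>The right-hand side is free of b, as domination in the limit requires. The kernel decays
  at rate s = r cos (\<gamma>/2) \<le> r, so each exponential moment e^(s^2 / 4b) lost in the
  mollification is at most e^(r^2 / 4b).\<close>

lemma abs_slice_mollified_le_exp:
  assumes \<gamma>: "0 < \<gamma>" "\<gamma> < pi" and pos: "0 < r" "0 < b"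
  shows "exp (- r\<^sup>2 / (4 * b)) * \<bar>slice_mollified \<gamma> b r y0\<bar> \<le> exp (- (r * \<bar>y0\<bar> * cos (\<gamma> / 2))) / (r ^ 3 * sin \<gamma>)"
proof -
  define s where "s = r * cos (\<gamma> / 2)"
  note trig = cos_half_pos[OF \<gamma>]
  have s: "0 < s" "s \<le> r" using trig pos by (simp_all add: s_def)
  define K where "K = exp (- (s * \<bar>y0\<bar>)) / (2 * r ^ 3 * sin \<gamma>)"
  have K: "0 \<le> K" using trig pos by (simp add: K_def)
  let ?E = "\<lambda>y. K * (exp (s * (y - y0)) * gaussian b y0 y + exp (- s * (y - y0)) * gaussian b y0 y)"
  have int_E: "integrable lborel ?E"
    using integral_exp_gaussian(1)[OF pos(2)] by (intro integrable_mult_right Bochner_Integration.integrable_add)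
  have "\<bar>slice_mollified \<gamma> b r y0\<bar> \<le> (LINT y|lborel. \<bar>slice_kernel \<gamma> r y * gaussian b y0 y\<bar>)"
    unfolding slice_mollified_def by (rule integral_abs_bound)
  also have "\<dots> \<le> (LINT y|lborel. ?E y)"
  proof (rule integral_mono[OF _ int_E])
    show "integrable lborel (\<lambda>y. \<bar>slice_kernel \<gamma> r y * gaussian b y0 y\<bar>)"
      using integrable_slice_mollified[OF \<gamma> pos] by (rule integrable_abs)
    fix y
    have "s * \<bar>y0\<bar> \<le> s * (\<bar>y\<bar> + \<bar>y - y0\<bar>)" using s by (intro mult_left_mono) auto
    then have "exp (- (s * \<bar>y\<bar>)) \<le> exp (- (s * \<bar>y0\<bar>)) * exp (s * \<bar>y - y0\<bar>)"
      unfolding exp_add[symmetric] by (simp add: algebra_simps)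
    \<comment> \<open>The absolute value is traded for two signed exponentials, whose Gaussian
      integrals are explicit; the resulting factor 2 cancels the 2 in the denominator of the
      kernel.\<close>
    also have "exp (s * \<bar>y - y0\<bar>) \<le> exp (s * (y - y0)) + exp (- s * (y - y0))"
      by (cases "y \<ge> y0") (simp_all add: add_increasing add_increasing2 algebra_simps)
    finally have "exp (- (s * \<bar>y\<bar>)) / (2 * r ^ 3 * sin \<gamma>) \<le>
       exp (- (s * \<bar>y0\<bar>)) * (exp (s * (y - y0)) + exp (- s * (y - y0))) / (2 * r ^ 3 * sin \<gamma>)"
      using trig pos by (intro divide_right_mono) auto
    then have "\<bar>slice_kernel \<gamma> r y\<bar> \<le> K * (exp (s * (y - y0)) + exp (- s * (y - y0)))"
      using abs_slice_kernel_le[OF \<gamma> pos(1), of y] by (simp add: K_def s_def mult_ac)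
    then have "\<bar>slice_kernel \<gamma> r y\<bar> * gaussian b y0 y \<le> K * (exp (s * (y - y0)) + exp (- s * (y - y0))) * gaussian b y0 y"
      by (intro mult_right_mono) simp_all
    then show "\<bar>slice_kernel \<gamma> r y * gaussian b y0 y\<bar> \<le> ?E y"
      by (simp add: abs_mult algebra_simps)
  qed
  also have "\<dots> = K * (2 * exp (s\<^sup>2 / (4 * b)))"
    using integral_exp_gaussian[OF pos(2), of s y0] integral_exp_gaussian[OF pos(2), of "- s" y0]
    by simp
  also have "\<dots> \<le> K * (2 * exp (r\<^sup>2 / (4 * b)))"
    using K s pos by (intro mult_left_mono) (auto intro!: divide_right_mono power_mono)
  finally have "exp (- r\<^sup>2 / (4 * b)) * \<bar>slice_mollified \<gamma> b r y0\<bar> \<le> exp (- r\<^sup>2 / (4 * b)) * (K * (2 * exp (r\<^sup>2 / (4 * b))))"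
    by (intro mult_left_mono) auto
  also have "\<dots> = 2 * K * (exp (- r\<^sup>2 / (4 * b)) * exp (r\<^sup>2 / (4 * b)))" by simp
  also have "\<dots> = 2 * K" unfolding exp_add[symmetric] by simp
  finally show ?thesis by (simp add: K_def s_def mult_ac)
qed

lemma slice_mollified_tendsto:
  assumes \<gamma>: "0 < \<gamma>" "\<gamma> < pi" and pos: "0 < r"
  shows "(\<lambda>j. slice_mollified \<gamma> (real (Suc j)) r y0) \<longlonglongrightarrow> slice_kernel \<gamma> r y0"
proof -
  have "(\<lambda>j. LINT y|lborel. complex_of_real (slice_kernel \<gamma> r y) * complex_of_real (gaussian (real (Suc j)) y0 y))
     \<longlonglongrightarrow> complex_of_real (slice_kernel \<gamma> r y0)"
  proof (rule gaussian_approximate_identity)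
    have "exp (- (norm (y - y0))\<^sup>2) = (1 / pi) powr (- 1 / 2) * gaussian 1 y0 y" for y
      by (simp add: gaussian_def powr_minus flip: mult.assoc)
    then have "slice_kernel \<gamma> r y * exp (- (norm (y - y0))\<^sup>2) = (1 / pi) powr (- 1 / 2) * (slice_kernel \<gamma> r y * gaussian 1 y0 y)" for y
      by simp
    then have "integrable lborel (\<lambda>y. slice_kernel \<gamma> r y * exp (- (norm (y - y0))\<^sup>2))"
      using integrable_slice_mollified[OF \<gamma> pos, of 1 y0] by (simp only: integrable_mult_right zero_less_one)
    from integrable_of_real[OF this, where 'a = complex]
    show "integrable lborel (\<lambda>y. complex_of_real (slice_kernel \<gamma> r y) * complex_of_real (exp (- (norm (y - y0))\<^sup>2)))"
      by simp
    show "isCont (\<lambda>y. complex_of_real (slice_kernel \<gamma> r y)) y0"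
      unfolding slice_kernel_def using pos cos_half_pos[OF \<gamma>] by (intro continuous_intros) auto
  qed
  then have "(\<lambda>j. complex_of_real (slice_mollified \<gamma> (real (Suc j)) r y0)) \<longlonglongrightarrow> complex_of_real (slice_kernel \<gamma> r y0)"
    unfolding slice_mollified_def by (simp only: flip: of_real_mult integral_complex_of_real)
  then show ?thesis by (simp only: tendsto_of_real_iff)
qed

text \<open>A multiplication formula in place of Fourier inversion: the double integral of e^(i y0
  \<xi>) E(\<xi>) e^(-i \<xi> y) G(y) is taken in both orders. Integrating over y first produces the
  reciprocal symbol, over \<xi> first a Gaussian centred at y0. Absolute convergence is immediate,
  since E and G are integrable separately.\<close>

lemma slice_symbol_integral:
  assumes \<gamma>: "0 < \<gamma>" "\<gamma> < pi" and r: "0 < r" and b: "0 < b"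
  shows "integrable lborel (\<lambda>\<xi>. exp (- \<xi>\<^sup>2 / (4 * b)) / (r ^ 4 + 2 * cos \<gamma> * r\<^sup>2 * \<xi>\<^sup>2 + \<xi> ^ 4))"
    and "(LINT \<xi>|lborel. iexp (y0 * \<xi>) * complex_of_real (exp (- \<xi>\<^sup>2 / (4 * b)) / (r ^ 4 + 2 * cos \<gamma> * r\<^sup>2 * \<xi>\<^sup>2 + \<xi> ^ 4))) =
       complex_of_real (2 * pi * slice_mollified \<gamma> b r y0)"
proof -
  define E where "E \<xi> = exp (- \<xi>\<^sup>2 / (4 * b))" for \<xi>
  define D where "D \<xi> = r ^ 4 + 2 * cos \<gamma> * r\<^sup>2 * \<xi>\<^sup>2 + \<xi> ^ 4" for \<xi>
  \<comment> \<open>sqrt (4 pi b) is the mass of e^(-\<xi>^2 / 4b), which is thus C times a Gaussian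
    of parameter 1/(4b). Its transform has exponent - b times a square, and C = 2 pi sqrt (b / pi)
    supplies both the normalisation and the 2 pi.\<close>
  define C where "C = (4 * b * pi) powr (1 / 2)"
  define G where "G y = complex_of_real (slice_kernel \<gamma> r y)" for y
  have E_gauss: "E \<xi> = C * gaussian (1 / (4 * b)) 0 \<xi>" for \<xi>
    using b by (simp add: E_def C_def gaussian_def powr_divide)
  have [measurable]: "E \<in> borel_measurable borel" "G \<in> borel_measurable borel"
    unfolding E_def G_def by measurable
  have b': "0 < 1 / (4 * b)" using b by simp
  have int_E: "integrable lborel E"
    unfolding E_gauss[abs_def] using gaussian_real_char(1)[OF b'] by (rule integrable_mult_right)
  have int_G: "integrable lborel G"
    using fourier_slice_kernel(1)[OF \<gamma> r, of 0] by (simp add: G_def[abs_def])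
  define f where "f \<xi> y = iexp (y0 * \<xi>) * complex_of_real (E \<xi>) * (iexp (- (\<xi> * y)) * G y)" for \<xi> y
  have norm_f: "norm (f \<xi> y) = E \<xi> * norm (G y)" for \<xi> y
    by (simp add: f_def norm_mult E_def)
  have f_int: "integrable (lborel \<Otimes>\<^sub>M lborel) (case_prod f)"
  proof (rule lborel_pair.Fubini_integrable)
    show "case_prod f \<in> borel_measurable (lborel \<Otimes>\<^sub>M lborel)" unfolding f_def by measurable
    show "integrable lborel (\<lambda>\<xi>. LINT y|lborel. norm (case_prod f (\<xi>, y)))"
      using int_E by (simp add: norm_f)
    have "integrable lborel (f \<xi>)" for \<xi>
    proof (rule integrable_norm_cancel)
      show "integrable lborel (\<lambda>y. norm (f \<xi> y))"
        using int_G by (simp add: norm_f)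
      show "f \<xi> \<in> borel_measurable lborel" unfolding f_def[abs_def] by measurable
    qed
    then show "AE \<xi> in lborel. integrable lborel (\<lambda>y. case_prod f (\<xi>, y))" by simp
  qed
  have inner1: "(LINT y|lborel. f \<xi> y) = iexp (y0 * \<xi>) * complex_of_real (E \<xi> / D \<xi>)" for \<xi>
    unfolding f_def G_def using fourier_slice_kernel(2)[OF \<gamma> r, of \<xi>] by (simp add: D_def)
  have inner2: "(LINT \<xi>|lborel. f \<xi> y) = complex_of_real (2 * pi * (slice_kernel \<gamma> r y * gaussian b y0 y))" for y
  proof -
    have "(LINT \<xi>|lborel. f \<xi> y) = (LINT \<xi>|lborel. complex_of_real C * G y * (iexp ((y0 - y) * \<xi>) * complex_of_real (gaussian (1 / (4 * b)) 0 \<xi>)))"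
    proof (intro Bochner_Integration.integral_cong refl)
      fix \<xi>
      have "iexp ((y0 - y) * \<xi>) = iexp (y0 * \<xi>) * iexp (- (\<xi> * y))"
        unfolding exp_add[symmetric] by (simp add: algebra_simps)
      then show "f \<xi> y = complex_of_real C * G y * (iexp ((y0 - y) * \<xi>) * complex_of_real (gaussian (1 / (4 * b)) 0 \<xi>))"
        by (simp add: f_def E_gauss)
    qed
    also have "\<dots> = complex_of_real C * G y * (LINT \<xi>|lborel. iexp ((y0 - y) * \<xi>) * complex_of_real (gaussian (1 / (4 * b)) 0 \<xi>))"
      by (rule integral_mult_right_zero)
    also have "\<dots> = complex_of_real (slice_kernel \<gamma> r y * (C * exp (- (y0 - y)\<^sup>2 / (4 * (1 / (4 * b))))))"
      unfolding gaussian_real_char(2)[OF b'] by (simp add: G_def)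
    also have "C * exp (- (y0 - y)\<^sup>2 / (4 * (1 / (4 * b)))) = 2 * pi * gaussian b y0 y"
    proof -
      have "sqrt (4 * b * pi) = 2 * pi * sqrt (b / pi)"
        using b by (simp add: real_sqrt_mult real_sqrt_divide real_div_sqrt field_simps)
      then have "C = 2 * pi * (b / pi) powr (1 / 2)"
        using b by (simp add: C_def powr_half_sqrt)
      moreover have "exp (- (y0 - y)\<^sup>2 / (4 * (1 / (4 * b)))) = exp (- b * (norm (y - y0))\<^sup>2)"
        using b by (simp add: power2_commute)
      ultimately show ?thesis by (simp only: gaussian_def DIM_real of_nat_1 mult.assoc)
    qed
    finally show ?thesis by (simp add: mult_ac)
  qed
  have "integrable lborel (\<lambda>\<xi>. LINT y|lborel. f \<xi> y)"
    using lborel_pair.integrable_fst[OF f_int] .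
  then have "integrable lborel (\<lambda>\<xi>. norm (iexp (y0 * \<xi>) * complex_of_real (E \<xi> / D \<xi>)))"
    unfolding inner1 by (rule integrable_norm)
  moreover have "0 < D \<xi>" for \<xi> unfolding D_def by (rule slice_symbol_pos[OF \<gamma> r])
  then have "norm (iexp (y0 * \<xi>) * complex_of_real (E \<xi> / D \<xi>)) = E \<xi> / D \<xi>" for \<xi>
    by (simp add: norm_mult norm_divide E_def less_imp_le)
  ultimately have "integrable lborel (\<lambda>\<xi>. E \<xi> / D \<xi>)" by simp
  then show "integrable lborel (\<lambda>\<xi>. exp (- \<xi>\<^sup>2 / (4 * b)) / (r ^ 4 + 2 * cos \<gamma> * r\<^sup>2 * \<xi>\<^sup>2 + \<xi> ^ 4))"
    by (simp add: E_def D_def)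
  have "(LINT \<xi>|lborel. iexp (y0 * \<xi>) * complex_of_real (E \<xi> / D \<xi>)) = (LINT y|lborel. complex_of_real (2 * pi * (slice_kernel \<gamma> r y * gaussian b y0 y)))"
    using lborel_pair.Fubini_integral[OF f_int] unfolding inner1 inner2 by simp
  also have "\<dots> = complex_of_real (2 * pi * slice_mollified \<gamma> b r y0)"
    unfolding integral_complex_of_real slice_mollified_def by simp
  finally show "(LINT \<xi>|lborel. iexp (y0 * \<xi>) * complex_of_real (exp (- \<xi>\<^sup>2 / (4 * b)) / (r ^ 4 + 2 * cos \<gamma> * r\<^sup>2 * \<xi>\<^sup>2 + \<xi> ^ 4))) =
       complex_of_real (2 * pi * slice_mollified \<gamma> b r y0)"
    by (simp add: E_def D_def)
qed

section \<open>Radial integrals\<close>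

text \<open>
  As in the uniqueness proof for Haar measure: for \<open>g\<close> the indicator of the unit ball, the double
  integral of \<open>g(y) G(f(x) + y)\<close>, computed in both orders by translation invariance, gives
  \<open>(\<integral> G \<circ> f) (\<integral> g) = (\<integral> G) (\<integral> g)\<close>.
\<close>

lemma lborel_distr_orthogonal:
  fixes f :: "'a::euclidean_space \<Rightarrow> 'a"
  assumes f: "orthogonal_transformation f"
  shows "distr lborel borel f = lborel"
proof (rule measure_eqI)
  have lin: "linear f" using f by (rule orthogonal_transformation_linear)
  obtain f' where f': "\<And>x. f (f' x) = x"
    using orthogonal_transformation_surj[OF f] by (metis surjD)
  have [measurable]: "f \<in> borel_measurable borel"
    by (intro borel_measurable_continuous_onI linear_continuous_on lin[unfolded linear_conv_bounded_linear])
  define g where "g x = (indicator (ball 0 1) x :: ennreal)" for x :: 'a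
  have [measurable]: "g \<in> borel_measurable borel"
    unfolding g_def by (intro borel_measurable_indicator borel_open open_ball)
  have g_f: "g (f x) = g x" for x
    using orthogonal_transformation_norm[OF f] by (simp add: g_def indicator_def)
  have g_minus: "g (- x) = g x" for x by (simp add: g_def indicator_def)
  have shift: "(\<integral>\<^sup>+x. G (x + y) \<partial>lborel) = (\<integral>\<^sup>+x. G x \<partial>lborel)"
    if [measurable]: "G \<in> borel_measurable borel" for G :: "'a \<Rightarrow> ennreal" and y
  proof -
    have "(\<integral>\<^sup>+x. G x \<partial>lborel) = (\<integral>\<^sup>+x. G x \<partial>distr lborel borel ((+) y))"
      by (simp add: lborel_distr_plus)
    also have "\<dots> = (\<integral>\<^sup>+x. G (x + y) \<partial>lborel)"
      by (subst nn_integral_distr) (auto simp: add.commute)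
    finally show ?thesis ..
  qed
  define V where "V = (\<integral>\<^sup>+x. g x \<partial>lborel)"
  have V: "V = emeasure lborel (ball (0::'a) 1)"
    by (simp add: V_def g_def)
  have V_refl: "(\<integral>\<^sup>+x. g (c - x) \<partial>lborel) = V" for c
  proof -
    have "(\<integral>\<^sup>+x. g (c - x) \<partial>lborel) = (\<integral>\<^sup>+x. g (x + (- c)) \<partial>lborel)"
      by (intro nn_integral_cong) (metis g_minus minus_diff_eq diff_conv_add_uminus)
    then show ?thesis using shift[of g "- c"] by (simp only: V_def \<open>g \<in> borel_measurable borel\<close>)
  qed
  have V0: "V \<noteq> 0" "V \<noteq> top"
  proof -
    show "V \<noteq> 0" using open_not_negligible[of "ball (0::'a) 1"]
      by (auto simp: V negligible_iff_null_sets null_sets_def emeasure_completion)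
    show "V \<noteq> top" unfolding V using emeasure_bounded_finite[OF bounded_ball] by (metis less_irrefl infinity_ennreal_def)
  qed
  fix A :: "'a set" assume "A \<in> sets (distr lborel borel f)"
  then have [measurable]: "A \<in> sets borel" by simp
  define G where "G x = (indicator A x :: ennreal)" for x
  have [measurable]: "G \<in> borel_measurable borel" unfolding G_def by measurable
  have "(\<integral>\<^sup>+x. G (f x) \<partial>lborel) * V = (\<integral>\<^sup>+y. g y * (\<integral>\<^sup>+x. G (f x) \<partial>lborel) \<partial>lborel)"
    by (simp add: nn_integral_multc V_def mult.commute)
  also have "\<dots> = (\<integral>\<^sup>+y. g y * (\<integral>\<^sup>+x. G (f x + y) \<partial>lborel) \<partial>lborel)"
  proof (intro nn_integral_cong)
    fix y
    have "(\<integral>\<^sup>+x. G (f x) \<partial>lborel) = (\<integral>\<^sup>+x. G (f (x + f' y)) \<partial>lborel)"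
      by (subst shift[of "\<lambda>x. G (f x)"]) auto
    also have "\<dots> = (\<integral>\<^sup>+x. G (f x + y) \<partial>lborel)"
      by (simp add: linear_add[OF lin] f')
    finally show "g y * (\<integral>\<^sup>+x. G (f x) \<partial>lborel) = g y * (\<integral>\<^sup>+x. G (f x + y) \<partial>lborel)" by simp
  qed
  also have "\<dots> = (\<integral>\<^sup>+y. (\<integral>\<^sup>+x. g y * G (f x + y) \<partial>lborel) \<partial>lborel)"
    by (simp add: nn_integral_cmult)
  also have "\<dots> = (\<integral>\<^sup>+x. (\<integral>\<^sup>+y. g y * G (f x + y) \<partial>lborel) \<partial>lborel)"
    by (intro lborel_pair.Fubini') measurable
  also have "\<dots> = (\<integral>\<^sup>+x. (\<integral>\<^sup>+y. g (y - f x) * G y \<partial>lborel) \<partial>lborel)"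
  proof (rule nn_integral_cong)
    fix x
    show "(\<integral>\<^sup>+y. g y * G (f x + y) \<partial>lborel) = (\<integral>\<^sup>+y. g (y - f x) * G y \<partial>lborel)"
      using shift[of "\<lambda>y. g (y - f x) * G y" "f x"] by (simp add: add.commute)
  qed
  also have "\<dots> = (\<integral>\<^sup>+y. (\<integral>\<^sup>+x. g (y - f x) * G y \<partial>lborel) \<partial>lborel)"
    by (intro lborel_pair.Fubini') measurable
  also have "\<dots> = (\<integral>\<^sup>+y. (\<integral>\<^sup>+x. g (f' y - x) \<partial>lborel) * G y \<partial>lborel)"
  proof (intro nn_integral_cong)
    fix y
    \<comment> \<open>Here y - f x = f (f' y - x), and f preserves the ball, so the rotation
      disappears; a reflected translate of the ball remains, with integral \<open>V\<close> by
      \<open>V_refl\<close>.\<close>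
    have "g (y - f x) = g (f' y - x)" for x
      using g_f[of "f' y - x"] by (simp add: linear_diff[OF lin] f')
    then show "(\<integral>\<^sup>+x. g (y - f x) * G y \<partial>lborel) = (\<integral>\<^sup>+x. g (f' y - x) \<partial>lborel) * G y"
      by (simp add: nn_integral_multc)
  qed
  also have "\<dots> = (\<integral>\<^sup>+y. G y \<partial>lborel) * V"
    by (simp add: V_refl nn_integral_cmult mult.commute)
  finally have "(\<integral>\<^sup>+x. G (f x) \<partial>lborel) = (\<integral>\<^sup>+y. G y \<partial>lborel)"
    using V0 by (simp add: ennreal_mult_cancel_left mult.commute[of _ V])
  moreover have "emeasure (distr lborel borel f) A = (\<integral>\<^sup>+x. G x \<partial>distr lborel borel f)"
    by (simp add: G_def)
  then have "emeasure (distr lborel borel f) A = (\<integral>\<^sup>+x. G (f x) \<partial>lborel)"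
    by (simp add: nn_integral_distr)
  moreover have "(\<integral>\<^sup>+y. G y \<partial>lborel) = emeasure lborel A" by (simp add: G_def)
  ultimately show "emeasure (distr lborel borel f) A = emeasure lborel A" by simp
qed simp

section \<open>Polar coordinates\<close>

text \<open>Up to a constant, the value is the volume of the k-dimensional ball where sqrt (c^2 +
  |f|^2) \<le> r, and the integrand is its density in the radius. The interior form of the
  fundamental theorem is used because the inner square root is not differentiable at s = c.\<close>

lemma has_integral_shell:
  fixes c r :: real and k :: nat
  assumes "0 \<le> c" "c \<le> r" "2 \<le> k"
  shows "((\<lambda>s. real k * s * sqrt (s\<^sup>2 - c\<^sup>2) ^ (k - 2)) has_integral sqrt (r\<^sup>2 - c\<^sup>2) ^ k) {c..r}"
proof -
  have "((\<lambda>s. real k * s * sqrt (s\<^sup>2 - c\<^sup>2) ^ (k - 2)) has_integral sqrt (r\<^sup>2 - c\<^sup>2) ^ k - sqrt (c\<^sup>2 - c\<^sup>2) ^ k) {c..r}"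
  proof (rule fundamental_theorem_of_calculus_interior[OF assms(2)])
    show "continuous_on {c..r} (\<lambda>s. sqrt (s\<^sup>2 - c\<^sup>2) ^ k)" by (intro continuous_intros)
    fix s assume "s \<in> {c<..<r}"
    then have s: "0 < s\<^sup>2 - c\<^sup>2" using assms power_strict_mono[of c s 2] by simp
    obtain j where j: "k = Suc (Suc j)" using assms(3) by (metis add_2_eq_Suc le_Suc_ex)
    have "((\<lambda>s. sqrt (s\<^sup>2 - c\<^sup>2) ^ k) has_real_derivative real k * s * sqrt (s\<^sup>2 - c\<^sup>2) ^ (k - 2)) (at s)"
    proof -
      have "((\<lambda>s. sqrt (s\<^sup>2 - c\<^sup>2)) has_real_derivative s / sqrt (s\<^sup>2 - c\<^sup>2)) (at s)"
        using s by (auto intro!: derivative_eq_intros simp: divide_simps)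
      from DERIV_power[OF this, of k] show ?thesis
        using s by (simp add: j mult.assoc)
    qed
    then show "((\<lambda>s. sqrt (s\<^sup>2 - c\<^sup>2) ^ k) has_vector_derivative real k * s * sqrt (s\<^sup>2 - c\<^sup>2) ^ (k - 2)) (at s)"
      by (simp add: has_real_derivative_iff_has_vector_derivative)
  qed
  then show ?thesis using assms by (simp add: power_0_left)
qed

text \<open>The offset c covers two uses: c = 0 gives the law of the norm, c = |t| its law on the
  slice where one further coordinate equals t. Both measures are compared on the half-lines
  \<open>{..r}\<close>, where only ball volumes enter.\<close>

lemma distr_PiM_norm:
  fixes c :: real
  assumes A: "finite A" "2 \<le> card A" and c: "0 \<le> c"
  shows "distr (Pi\<^sub>M A (\<lambda>_. lborel)) borel (\<lambda>f. sqrt (c\<^sup>2 + (\<Sum>i\<in>A. (f i)\<^sup>2))) =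
    density lborel (\<lambda>r. ennreal (if c < r then unit_ball_vol (card A) * (card A * r * sqrt (r\<^sup>2 - c\<^sup>2) ^ (card A - 2)) else 0))"
    (is "?M = ?N")
proof (rule measure_eqI_generator_eq)
  interpret product_sigma_finite "\<lambda>_. lborel :: real measure" by standard
  let ?P = "Pi\<^sub>M A (\<lambda>_. lborel :: real measure)"
  let ?E = "range (\<lambda>r::real. {..r})"
  define V where "V = unit_ball_vol (real (card A))"
  have V: "0 \<le> V" by (simp add: V_def)
  have "{..a} \<inter> {..b} = {..min a b}" for a b :: real by auto
  then show "Int_stable ?E" by (auto simp: Int_stable_def)
  show "sets ?M = sigma_sets UNIV ?E" "sets ?N = sigma_sets UNIV ?E"
    by (simp_all add: borel_eq_atMost)
  show "range (\<lambda>i. {..real i}) \<subseteq> ?E" "(\<Union>i. {..real i}) = UNIV"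
    by (auto simp: real_arch_simple)
  have emeasure_M: "emeasure ?M {..r} = ennreal (if c < r then V * sqrt (r\<^sup>2 - c\<^sup>2) ^ card A else 0)" for r
  proof -
    have 1: "emeasure ?M {..r} = emeasure ?P ({f. sqrt (c\<^sup>2 + (\<Sum>i\<in>A. (f i)\<^sup>2)) \<le> r} \<inter> space ?P)"
      by (subst emeasure_distr) (auto simp: vimage_def)
    show ?thesis
    proof (cases "c < r")
      case True
      have "sqrt (c\<^sup>2 + S) \<le> r \<longleftrightarrow> sqrt S \<le> sqrt (r\<^sup>2 - c\<^sup>2)" if "0 \<le> S" for S
        using True c that by (auto simp: real_sqrt_le_iff')
      then have "{f. sqrt (c\<^sup>2 + (\<Sum>i\<in>A. (f i)\<^sup>2)) \<le> r} = {f. sqrt (\<Sum>i\<in>A. (f i)\<^sup>2) \<le> sqrt (r\<^sup>2 - c\<^sup>2)}"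
        by (simp add: sum_nonneg)
      moreover have "0 < sqrt (r\<^sup>2 - c\<^sup>2)"
        using True c power_strict_mono[of c r 2] by simp
      ultimately show ?thesis
        using emeasure_cball_aux[OF A(1), of "sqrt (r\<^sup>2 - c\<^sup>2)"] True by (simp only: 1 V_def if_True)
    next
      \<comment> \<open>For r \<le> c the set contains at most the origin, a null set since A is
        nonempty.\<close>
      case False
      have "f \<in> A \<rightarrow>\<^sub>E {0}" if "sqrt (c\<^sup>2 + (\<Sum>i\<in>A. (f i)\<^sup>2)) \<le> r" "f \<in> space ?P" for f
      proof -
        have "sqrt (c\<^sup>2 + (\<Sum>i\<in>A. (f i)\<^sup>2)) \<le> c" using that(1) False by linarith
        then have "(\<Sum>i\<in>A. (f i)\<^sup>2) \<le> 0"
          using c by (subst (asm) real_sqrt_le_iff') (auto simp: sum_nonneg)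
        then have "(\<Sum>i\<in>A. (f i)\<^sup>2) = 0" by (simp add: antisym sum_nonneg)
        then have "\<forall>i\<in>A. f i = 0" using A(1) by (simp add: sum_nonneg_eq_0_iff)
        then show ?thesis using that(2) by (intro PiE_I) (auto simp: space_PiM)
      qed
      then have "emeasure ?P ({f. sqrt (c\<^sup>2 + (\<Sum>i\<in>A. (f i)\<^sup>2)) \<le> r} \<inter> space ?P) \<le> emeasure ?P (A \<rightarrow>\<^sub>E {0})"
        using A(1) by (intro emeasure_mono sets_PiM_I_finite) auto
      also have "\<dots> = 0" using A by (subst emeasure_PiM) (auto simp: card_gt_0_iff)
      finally show ?thesis using False 1 by simp
    qed
  qed
  have emeasure_N: "emeasure ?N {..r} = ennreal (if c < r then V * sqrt (r\<^sup>2 - c\<^sup>2) ^ card A else 0)" for r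
  proof -
    have "emeasure ?N {..r} = (\<integral>\<^sup>+s. ennreal (if c < s then V * (card A * s * sqrt (s\<^sup>2 - c\<^sup>2) ^ (card A - 2)) else 0) * indicator {..r} s \<partial>lborel)"
      unfolding V_def by (subst emeasure_density) auto
    also have "\<dots> = (\<integral>\<^sup>+s. ennreal (V * (card A * s * sqrt (s\<^sup>2 - c\<^sup>2) ^ (card A - 2))) * indicator {c..r} s \<partial>lborel)"
    \<comment> \<open>When \<open>card A = 2\<close> the integrands may differ at s = c, because
      \<open>0 ^ 0 = 1\<close>; hence equality only almost everywhere.\<close>
    proof (intro nn_integral_cong_AE)
      have "AE s in lborel. s \<noteq> c" by (rule AE_lborel_singleton)
      then show "AE s in lborel. ennreal (if c < s then V * (card A * s * sqrt (s\<^sup>2 - c\<^sup>2) ^ (card A - 2)) else 0) * indicator {..r} s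
        = ennreal (V * (card A * s * sqrt (s\<^sup>2 - c\<^sup>2) ^ (card A - 2))) * indicator {c..r} s"
        by eventually_elim (auto simp: indicator_def)
    qed
    also have "\<dots> = ennreal (if c < r then V * sqrt (r\<^sup>2 - c\<^sup>2) ^ card A else 0)"
    proof (cases "c < r")
      case True
      have nn: "0 \<le> V * (real (card A) * s * sqrt (s\<^sup>2 - c\<^sup>2) ^ (card A - 2))" if "s \<in> {c..r}" for s
      proof -
        have "c\<^sup>2 \<le> s\<^sup>2" "0 \<le> s" using that c by (auto intro: power_mono)
        then show ?thesis using V by simp
      qed
      show ?thesis
        using nn_integral_has_integral_lebesgue'[OF nn has_integral_mult_right[OF has_integral_shell[OF c less_imp_le[OF True] A(2)], of V]] True
        by simp
    next
      case False
      have "AE s in lborel. s \<noteq> c" by (rule AE_lborel_singleton)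
      then have "AE s in lborel. ennreal (V * (card A * s * sqrt (s\<^sup>2 - c\<^sup>2) ^ (card A - 2))) * indicator {c..r} s = 0"
        by eventually_elim (use False in \<open>auto simp: indicator_def\<close>)
      then show ?thesis using False by (subst nn_integral_cong_AE[where v = "\<lambda>_. 0"]) auto
    qed
    finally show ?thesis .
  qed
  show "emeasure ?M X = emeasure ?N X" if "X \<in> ?E" for X
    using that emeasure_M emeasure_N by auto
  show "emeasure ?M {..real i} \<noteq> \<infinity>" for i
    unfolding emeasure_M by simp
qed simp

lemma norm_sum_Basis:
  "norm (\<Sum>b\<in>Basis. f b *\<^sub>R b :: 'a::euclidean_space) = sqrt (\<Sum>b\<in>(Basis::'a set). (f b)\<^sup>2)"
  unfolding norm_eq_sqrt_inner euclidean_inner[of "\<Sum>b\<in>Basis. f b *\<^sub>R b" "\<Sum>b\<in>Basis. f b *\<^sub>R b"]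
  by (simp add: power2_eq_square)

lemma distr_lborel_norm:
  assumes "2 \<le> DIM('a::euclidean_space)"
  shows "distr lborel borel (norm :: 'a \<Rightarrow> real) =
    density lborel (\<lambda>r. ennreal (if 0 < r then unit_ball_vol DIM('a) * (DIM('a) * r ^ (DIM('a) - 1)) else 0))"
proof -
  have "distr lborel borel (norm :: 'a \<Rightarrow> real) =
     distr (Pi\<^sub>M (Basis::'a set) (\<lambda>_. lborel)) borel (\<lambda>f. sqrt (0\<^sup>2 + (\<Sum>b\<in>(Basis::'a set). (f b)\<^sup>2)))"
    unfolding lborel_eq[where 'a='a] by (subst distr_distr) (auto simp: o_def norm_sum_Basis)
  also have "\<dots> = density lborel (\<lambda>r. ennreal (if 0 < r then unit_ball_vol DIM('a) * (DIM('a) * r * sqrt (r\<^sup>2 - 0\<^sup>2) ^ (DIM('a) - 2)) else 0))"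
    by (rule distr_PiM_norm) (use assms in auto)
  also have "\<dots> = density lborel (\<lambda>r. ennreal (if 0 < r then unit_ball_vol DIM('a) * (DIM('a) * r ^ (DIM('a) - 1)) else 0))"
  proof -
    obtain j where "DIM('a) = Suc (Suc j)" using assms by (metis add_2_eq_Suc le_Suc_ex)
    then show ?thesis by (intro arg_cong[of _ _ "density lborel"] ext) simp
  qed
  finally show ?thesis .
qed

text \<open>A plane wave along e times a radial function depends only on the coordinate along e and
  on the norm, so their joint law can replace spherical coordinates. It is found by splitting off
  the coordinate t and applying \<open>distr_PiM_norm\<close> to the other k.\<close>

lemma distr_lborel_inner_norm:
  fixes e :: "'a::euclidean_space"
  assumes e: "e \<in> Basis" and k: "DIM('a) = Suc k" "2 \<le> k"
  shows "distr lborel (borel \<Otimes>\<^sub>M borel) (\<lambda>x. (x \<bullet> e, norm x)) =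
    density (lborel \<Otimes>\<^sub>M lborel)
      (\<lambda>(t, r). ennreal (if \<bar>t\<bar> < r then unit_ball_vol k * (k * r * sqrt (r\<^sup>2 - t\<^sup>2) ^ (k - 2)) else 0))"
    (is "?M = density _ ?w")
proof (rule measure_eqI)
  interpret product_sigma_finite "\<lambda>_::'a. lborel :: real measure" by standard
  fix X assume "X \<in> sets ?M"
  then have X[measurable]: "X \<in> sets (borel \<Otimes>\<^sub>M borel)" by simp
  let ?B = "Basis - {e}"
  let ?I = "indicator X :: real \<times> real \<Rightarrow> ennreal"
  have B: "finite ?B" "e \<notin> ?B" "insert e ?B = Basis" "card ?B = k"
    using e k by auto
  have [measurable]: "?I \<in> borel_measurable (borel \<Otimes>\<^sub>M borel)" by measurable
  have e_sum: "(\<Sum>b\<in>Basis. f b *\<^sub>R b) \<bullet> e = f e" for f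
    using e by simp
  have "emeasure ?M X = (\<integral>\<^sup>+x. ?I (x \<bullet> e, norm x) \<partial>lborel)"
    by (subst nn_integral_distr[symmetric, where M' = "borel \<Otimes>\<^sub>M borel"]) auto
  also have "\<dots> = (\<integral>\<^sup>+f. ?I (f e, sqrt (\<Sum>b\<in>Basis. (f b)\<^sup>2)) \<partial>Pi\<^sub>M (insert e ?B) (\<lambda>_. lborel))"
    unfolding lborel_eq[where 'a='a] B
    by (subst nn_integral_distr) (auto simp: e_sum norm_sum_Basis)
  also have "\<dots> = (\<integral>\<^sup>+t. (\<integral>\<^sup>+f. ?I (t, sqrt (\<Sum>b\<in>Basis. ((f(e := t)) b)\<^sup>2)) \<partial>Pi\<^sub>M ?B (\<lambda>_. lborel)) \<partial>lborel)"
    using e by (subst product_nn_integral_insert_rev[OF B(1,2)]) auto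
  \<comment> \<open>The offset is written as \<bar>t\<bar> because \<open>distr_PiM_norm\<close>
    asks for a nonnegative one.\<close>
  also have "\<dots> = (\<integral>\<^sup>+t. (\<integral>\<^sup>+f. ?I (t, sqrt (\<bar>t\<bar>\<^sup>2 + (\<Sum>b\<in>?B. (f b)\<^sup>2))) \<partial>Pi\<^sub>M ?B (\<lambda>_. lborel)) \<partial>lborel)"
  proof -
    have "(\<Sum>b\<in>Basis. ((f(e := t)) b)\<^sup>2) = \<bar>t\<bar>\<^sup>2 + (\<Sum>b\<in>?B. (f b)\<^sup>2)" for f :: "'a \<Rightarrow> real" and t
    proof -
      have "(\<Sum>b\<in>insert e ?B. ((f(e := t)) b)\<^sup>2) = \<bar>t\<bar>\<^sup>2 + (\<Sum>b\<in>?B. (f b)\<^sup>2)"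
        unfolding sum.insert[OF B(1,2)] by (auto intro!: sum.cong)
      then show ?thesis by (simp only: B(3))
    qed
    then show ?thesis by simp
  qed
  also have "\<dots> = (\<integral>\<^sup>+t. (\<integral>\<^sup>+r. ?w (t, r) * ?I (t, r) \<partial>lborel) \<partial>lborel)"
  proof (rule nn_integral_cong)
    fix t :: real
    have "(\<integral>\<^sup>+f. ?I (t, sqrt (\<bar>t\<bar>\<^sup>2 + (\<Sum>b\<in>?B. (f b)\<^sup>2))) \<partial>Pi\<^sub>M ?B (\<lambda>_. lborel)) =
      (\<integral>\<^sup>+r. ?I (t, r) \<partial>distr (Pi\<^sub>M ?B (\<lambda>_. lborel)) borel (\<lambda>f. sqrt (\<bar>t\<bar>\<^sup>2 + (\<Sum>b\<in>?B. (f b)\<^sup>2))))"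
      by (subst nn_integral_distr) auto
    also have "\<dots> = (\<integral>\<^sup>+r. ?w (t, r) * ?I (t, r) \<partial>lborel)"
    proof -
      have "distr (Pi\<^sub>M ?B (\<lambda>_. lborel)) borel (\<lambda>f. sqrt (\<bar>t\<bar>\<^sup>2 + (\<Sum>b\<in>?B. (f b)\<^sup>2))) = density lborel (\<lambda>r. ?w (t, r))"
        using distr_PiM_norm[OF B(1), of "\<bar>t\<bar>"] k by (simp only: B prod.case power2_abs abs_ge_zero simp_thms)
      then show ?thesis by (simp only:) (subst nn_integral_density, auto)
    qed
    finally show "(\<integral>\<^sup>+f. ?I (t, sqrt (\<bar>t\<bar>\<^sup>2 + (\<Sum>b\<in>?B. (f b)\<^sup>2))) \<partial>Pi\<^sub>M ?B (\<lambda>_. lborel)) =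
      (\<integral>\<^sup>+r. ?w (t, r) * ?I (t, r) \<partial>lborel)" .
  qed
  also have "\<dots> = (\<integral>\<^sup>+z. ?w z * ?I z \<partial>(lborel \<Otimes>\<^sub>M lborel))"
    by (rule lborel.nn_integral_fst) measurable
  also have "\<dots> = emeasure (density (lborel \<Otimes>\<^sub>M lborel) ?w) X"
    by (subst emeasure_density) auto
  finally show "emeasure ?M X = emeasure (density (lborel \<Otimes>\<^sub>M lborel) ?w) X" .
qed simp

lemma
  fixes h :: "real \<Rightarrow> real"
  assumes dim: "2 \<le> DIM('a::euclidean_space)" and [measurable]: "h \<in> borel_measurable borel"
  shows integrable_radial: "set_integrable lborel {0<..} (\<lambda>r. h r * r ^ (DIM('a) - 1)) \<Longrightarrow>
      integrable lborel (\<lambda>x::'a. h (norm x))"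
    and integral_radial: "(LINT x|lborel. h (norm (x::'a))) =
      DIM('a) * unit_ball_vol DIM('a) * (LBINT r:{0<..}. h r * r ^ (DIM('a) - 1))"
proof -
  define c where "c = DIM('a) * unit_ball_vol DIM('a)"
  define w where "w r = (if 0 < r then unit_ball_vol DIM('a) * (DIM('a) * r ^ (DIM('a) - 1)) else 0)" for r :: real
  have w: "distr lborel borel (norm :: 'a \<Rightarrow> real) = density lborel (\<lambda>r. ennreal (w r))"
    unfolding w_def by (rule distr_lborel_norm[OF dim])
  have w0: "0 \<le> w r" for r by (simp add: w_def)
  have [measurable]: "w \<in> borel_measurable borel" unfolding w_def by measurable
  have wh: "w r *\<^sub>R h r = c * (indicator {0<..} r *\<^sub>R (h r * r ^ (DIM('a) - 1)))" for r
    by (simp add: w_def c_def indicator_def)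
  have "integrable lborel (\<lambda>x::'a. h (norm x)) \<longleftrightarrow> integrable (distr lborel borel (norm :: 'a \<Rightarrow> real)) h"
    by (subst integrable_distr_eq) auto
  also have "\<dots> \<longleftrightarrow> integrable lborel (\<lambda>r. w r *\<^sub>R h r)"
    unfolding w by (subst integrable_density) (auto simp: w0)
  finally have iff: "integrable lborel (\<lambda>x::'a. h (norm x)) \<longleftrightarrow> integrable lborel (\<lambda>r. w r *\<^sub>R h r)" .
  show "set_integrable lborel {0<..} (\<lambda>r. h r * r ^ (DIM('a) - 1)) \<Longrightarrow> integrable lborel (\<lambda>x::'a. h (norm x))"
    unfolding iff wh set_integrable_def by (rule integrable_mult_right)
  have "(LINT x|lborel. h (norm (x::'a))) = integral\<^sup>L (distr lborel borel (norm :: 'a \<Rightarrow> real)) h"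
    by (subst integral_distr) auto
  also have "\<dots> = (LINT r|lborel. w r *\<^sub>R h r)"
    unfolding w by (subst integral_density) (auto simp: w0)
  also have "\<dots> = c * (LBINT r:{0<..}. h r * r ^ (DIM('a) - 1))"
    unfolding wh set_lebesgue_integral_def by (rule integral_mult_right_zero)
  finally show "(LINT x|lborel. h (norm (x::'a))) = DIM('a) * unit_ball_vol DIM('a) * (LBINT r:{0<..}. h r * r ^ (DIM('a) - 1))"
    by (simp add: c_def)
qed

text \<open>Substituting t = - r cos \<phi>, increasing on [0, pi], makes sqrt (r^2 - t^2) = r sin
  \<phi>. One more sine comes from dt, so the exponent is k - 1 = (k + 2) - 3; hence the index k + 2
  of \<open>C_fun\<close>.\<close>

lemma integral_latitude:
  assumes r: "0 < r" and k: "2 \<le> k"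
  shows "(LINT t|lborel. (if \<bar>t\<bar> < r then r * sqrt (r\<^sup>2 - t\<^sup>2) ^ (k - 2) * cos (A * t) else 0)) =
     r ^ k * C_fun (k + 2) (r * A)"
proof -
  define f where "f t = sqrt (r\<^sup>2 - t\<^sup>2) ^ (k - 2) * cos (A * t)" for t
  obtain j where j: "k = Suc (Suc j)" using k by (metis add_2_eq_Suc le_Suc_ex)
  have cont: "continuous_on S f" for S unfolding f_def by (intro continuous_intros)
  have [measurable]: "f \<in> borel_measurable borel" by (intro borel_measurable_continuous_onI cont)
  have "(LINT t|lborel. (if \<bar>t\<bar> < r then r * sqrt (r\<^sup>2 - t\<^sup>2) ^ (k - 2) * cos (A * t) else 0)) =
    (LINT t|lborel. r * (f t * indicator {- r * cos 0..- r * cos pi} t))"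
  proof (rule integral_cong_AE)
    have "AE t in lborel. t \<noteq> r" "AE t in lborel. t \<noteq> - r" by (rule AE_lborel_singleton)+
    then show "AE t in lborel. (if \<bar>t\<bar> < r then r * sqrt (r\<^sup>2 - t\<^sup>2) ^ (k - 2) * cos (A * t) else 0) =
       r * (f t * indicator {- r * cos 0..- r * cos pi} t)"
      by eventually_elim (auto simp: indicator_def f_def)
  qed auto
  also have "\<dots> = r * (LBINT t. f t * indicator {- r * cos 0..- r * cos pi} t)"
    by (rule integral_mult_right_zero)
  also have "(LBINT t. f t * indicator {- r * cos 0..- r * cos pi} t) =
     (LBINT \<phi>. f (- r * cos \<phi>) * (r * sin \<phi>) * indicator {0..pi} \<phi>)"
  proof (rule integral_substitution)
    show "set_integrable lborel {- r * cos 0..- r * cos pi} f"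
      by (intro borel_integrable_atLeastAtMost' cont)
    show "((\<lambda>\<phi>. - r * cos \<phi>) has_real_derivative r * sin \<phi>) (at \<phi>)" for \<phi>
      by (auto intro!: derivative_eq_intros)
    show "continuous_on {0..pi} (\<lambda>\<phi>. r * sin \<phi>)" by (intro continuous_intros)
    show "0 \<le> r * sin \<phi>" if "\<phi> \<in> {0..pi}" for \<phi> using r that by (simp add: sin_ge_zero)
  qed simp
  also have "\<dots> = (LINT \<phi>|lborel. r ^ Suc j * (indicator {0..pi} \<phi> *\<^sub>R (cos (r * A * cos \<phi>) * sin \<phi> ^ (k + 2 - 3))))"
  proof (intro Bochner_Integration.integral_cong refl)
    fix \<phi>
    have "f (- r * cos \<phi>) * (r * sin \<phi>) = r ^ Suc j * (cos (r * A * cos \<phi>) * sin \<phi> ^ (k + 2 - 3))" if "\<phi> \<in> {0..pi}"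
    proof -
      have "0 \<le> sin \<phi>" using that sin_ge_zero by simp
      have "r\<^sup>2 - (- r * cos \<phi>)\<^sup>2 = (r * sin \<phi>)\<^sup>2"
        by (simp add: power_mult_distrib sin_squared_eq algebra_simps)
      then have "sqrt (r\<^sup>2 - (- r * cos \<phi>)\<^sup>2) = r * sin \<phi>"
        using r \<open>0 \<le> sin \<phi>\<close> by simp
      then show ?thesis unfolding f_def by (simp add: j power_mult_distrib mult_ac)
    qed
    then show "f (- r * cos \<phi>) * (r * sin \<phi>) * indicator {0..pi} \<phi> =
        r ^ Suc j * (indicator {0..pi} \<phi> *\<^sub>R (cos (r * A * cos \<phi>) * sin \<phi> ^ (k + 2 - 3)))"
      by (simp add: indicator_def)
  qed
  also have "\<dots> = r ^ Suc j * C_fun (k + 2) (r * A)"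
    unfolding C_fun_def set_lebesgue_integral_def by (rule integral_mult_right_zero)
  finally show ?thesis by (simp add: j)
qed

text \<open>The sine part is odd and cancels, and a rotation turns a into |a| e, so the joint law of
  x \<bullet> e and |x| applies and \<open>integral_latitude\<close> evaluates the inner integral.
  The constant is the area of the unit sphere in R^k, one dimension below the space.\<close>

lemma fourier_radial:
  fixes h :: "real \<Rightarrow> real" and a :: "real ^ 'm::finite"
  assumes k: "CARD('m) = Suc k" "2 \<le> k" and [measurable]: "h \<in> borel_measurable borel"
    and int: "integrable lborel (\<lambda>x::real ^ 'm. h (norm x))"
  shows "(LINT x|lborel. iexp (a \<bullet> x) * complex_of_real (h (norm x))) =
    complex_of_real (k * unit_ball_vol k * (LBINT r:{0<..}. C_fun (k + 2) (r * norm a) * h r * r ^ k))"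
proof -
  have distr_integral: "(LINT x|lborel. g (f x)) = (LINT x|lborel. g x)"
    if f: "orthogonal_transformation f" and g: "g \<in> borel_measurable borel" for f :: "real ^ 'm \<Rightarrow> real ^ 'm" and g :: "real ^ 'm \<Rightarrow> real"
  proof -
    have "f \<in> borel_measurable borel"
      by (intro borel_measurable_continuous_onI linear_continuous_on)
         (use orthogonal_transformation_linear[OF f] in \<open>simp add: linear_conv_bounded_linear\<close>)
    then show ?thesis
      using integral_distr[of f lborel borel g] g lborel_distr_orthogonal[OF f] by simp
  qed
  have int': "integrable lborel (\<lambda>x::real ^ 'm. g x * h (norm x))"
    if "g \<in> borel_measurable borel" "\<And>x. \<bar>g x\<bar> \<le> 1" for g :: "real ^ 'm \<Rightarrow> real"
  proof (rule Bochner_Integration.integrable_bound[OF int])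
    show "AE x in lborel. norm (g x * h (norm (x::real ^ 'm))) \<le> norm (h (norm x))"
      using that(2) by (auto simp: abs_mult intro!: mult_left_le_one_le)
  qed (use that(1) in measurable)
  have int_cos: "integrable lborel (\<lambda>x. cos (a \<bullet> x) * h (norm x))"
    and int_sin: "integrable lborel (\<lambda>x. sin (a \<bullet> x) * h (norm x))"
    by (rule int'; simp)+
  have "(LINT x|lborel. sin (a \<bullet> x) * h (norm x)) = (LINT x|lborel. sin (a \<bullet> (- x)) * h (norm (- x)))"
    by (rule distr_integral[symmetric]) (auto simp: orthogonal_transformation_def linear_uminus)
  also have "\<dots> = - (LINT x|lborel. sin (a \<bullet> x) * h (norm x))"
    by simp
  finally have odd: "(LINT x|lborel. sin (a \<bullet> x) * h (norm x)) = 0" by simp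
  have "(LINT x|lborel. iexp (a \<bullet> x) * complex_of_real (h (norm x))) =
    (LINT x|lborel. complex_of_real (cos (a \<bullet> x) * h (norm x)) + \<i> * complex_of_real (sin (a \<bullet> x) * h (norm x)))"
    by (simp add: cis_conv_exp[symmetric] cis.code Complex_eq algebra_simps)
  also have "\<dots> = complex_of_real (LINT x|lborel. cos (a \<bullet> x) * h (norm x)) + \<i> * complex_of_real (LINT x|lborel. sin (a \<bullet> x) * h (norm x))"
    using int_cos int_sin by (subst Bochner_Integration.integral_add) (auto intro!: integrable_mult_right simp del: of_real_mult)
  also have "\<dots> = complex_of_real (LINT x|lborel. cos (a \<bullet> x) * h (norm x))"
    by (simp add: odd)
  finally have 1: "(LINT x|lborel. iexp (a \<bullet> x) * complex_of_real (h (norm x))) =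
     complex_of_real (LINT x|lborel. cos (a \<bullet> x) * h (norm x))" .

  obtain e :: "real ^ 'm" where e: "e \<in> Basis" using nonempty_Basis by blast
  define A where "A = norm a"
  \<comment> \<open>Both vectors have norm \<open>A\<close>, so the rotation exists also for a =
    0.\<close>
  obtain f where f: "orthogonal_transformation f" "f (A *\<^sub>R e) = a"
    using orthogonal_transformation_exists[of "A *\<^sub>R e" a] e by (auto simp: A_def)
  have "a \<bullet> f x = A * (x \<bullet> e)" for x
    using f orthogonal_transformation_def[of f] by (metis inner_commute inner_scaleR_left)
  moreover have "norm (f x) = norm x" for x using f(1) by (rule orthogonal_transformation_norm)
  ultimately have 2: "(LINT x|lborel. cos (a \<bullet> x) * h (norm x)) = (LINT x|lborel. cos (A * (x \<bullet> e)) * h (norm x))"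
    using distr_integral[OF f(1), of "\<lambda>x. cos (a \<bullet> x) * h (norm x)"] by simp

  define V where "V = unit_ball_vol k"
  have V: "0 \<le> V" by (simp add: V_def)
  define w where "w = (\<lambda>(t::real, r::real). if \<bar>t\<bar> < r then V * (k * r * sqrt (r\<^sup>2 - t\<^sup>2) ^ (k - 2)) else 0)"
  have w0: "0 \<le> w z" for z
  proof -
    have "t\<^sup>2 \<le> r\<^sup>2" if "\<bar>t\<bar> < r" for t r :: real
      using that power_mono[of "\<bar>t\<bar>" r 2] by simp
    then show ?thesis using V by (auto simp: w_def split: prod.split)
  qed
  have [measurable]: "w \<in> borel_measurable (borel \<Otimes>\<^sub>M borel)" unfolding w_def by measurable
  have D: "distr lborel (borel \<Otimes>\<^sub>M borel) (\<lambda>x. (x \<bullet> e, norm x)) = density (lborel \<Otimes>\<^sub>M lborel) (\<lambda>z. ennreal (w z))"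
    using distr_lborel_inner_norm[OF e, of k] k by (simp only: w_def V_def case_prod_unfold DIM_cart DIM_real mult_1_right)
  have "integrable lborel (\<lambda>x. cos (A * (x \<bullet> e)) * h (norm x))" by (rule int') auto
  then have "integrable (distr lborel (borel \<Otimes>\<^sub>M borel) (\<lambda>x. (x \<bullet> e, norm x))) (\<lambda>z. cos (A * fst z) * h (snd z))"
    by (subst integrable_distr_eq) auto
  then have int_w: "integrable (lborel \<Otimes>\<^sub>M lborel) (\<lambda>z. w z *\<^sub>R (cos (A * fst z) * h (snd z)))"
    unfolding D by (subst (asm) integrable_density) (auto simp: w0)
  have "(LINT x|lborel. cos (A * (x \<bullet> e)) * h (norm x)) =
     (LINT z|distr lborel (borel \<Otimes>\<^sub>M borel) (\<lambda>x. (x \<bullet> e, norm x)). cos (A * fst z) * h (snd z))"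
    by (subst integral_distr) auto
  also have "\<dots> = (LINT z|(lborel \<Otimes>\<^sub>M lborel). w z *\<^sub>R (cos (A * fst z) * h (snd z)))"
    unfolding D by (subst integral_density) (auto simp: w0)
  also have "\<dots> = (LINT r|lborel. LINT t|lborel. w (t, r) * (cos (A * t) * h r))"
    using lborel_pair.integral_snd[of "\<lambda>t r. w (t, r) * (cos (A * t) * h r)"] int_w
    by (simp add: case_prod_unfold)
  also have "\<dots> = (LINT r|lborel. (k * V) * (indicator {0<..} r *\<^sub>R (C_fun (k + 2) (r * A) * h r * r ^ k)))"
  proof (intro Bochner_Integration.integral_cong refl)
    fix r :: real
    show "(LINT t|lborel. w (t, r) * (cos (A * t) * h r)) = (k * V) * (indicator {0<..} r *\<^sub>R (C_fun (k + 2) (r * A) * h r * r ^ k))"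
    proof (cases "0 < r")
      case True
      have "(LINT t|lborel. w (t, r) * (cos (A * t) * h r)) =
        (LINT t|lborel. (k * V * h r) * (if \<bar>t\<bar> < r then r * sqrt (r\<^sup>2 - t\<^sup>2) ^ (k - 2) * cos (A * t) else 0))"
        by (intro Bochner_Integration.integral_cong refl) (simp add: w_def)
      also have "\<dots> = (k * V * h r) * (LINT t|lborel. (if \<bar>t\<bar> < r then r * sqrt (r\<^sup>2 - t\<^sup>2) ^ (k - 2) * cos (A * t) else 0))"
        by (rule integral_mult_right_zero)
      finally show ?thesis using True by (simp add: integral_latitude[OF True k(2)])
    next
      case False
      then have "w (t, r) = 0" for t by (auto simp: w_def)
      then show ?thesis using False by simp
    qed
  qed
  also have "\<dots> = (k * V) * (LBINT r:{0<..}. C_fun (k + 2) (r * A) * h r * r ^ k)"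
    unfolding set_lebesgue_integral_def by (rule integral_mult_right_zero)
  finally show ?thesis unfolding 1 2 by (simp add: V_def A_def)
qed

section \<open>The fundamental solution\<close>

lemma set_integrable_power_exp_neg_real:
  fixes c :: real assumes "0 < c"
  shows "set_integrable lborel {0<..} (\<lambda>t. t ^ k * exp (- c * t))"
proof -
  have "set_integrable lborel {0<..} (\<lambda>t. norm (complex_of_real t ^ k * exp (- complex_of_real c * complex_of_real t)))"
    using set_integrable_power_exp_neg[of "complex_of_real c" k] assms by (intro set_integrable_norm) simp
  then show ?thesis
    by (rule set_integrable_cong[THEN iffD1, rotated 3]) (auto simp: norm_mult norm_power)
qed

text \<open>The volume factor r^(m - 1) with m \<ge> 4 cancels the cube; this is where n \<ge> 5
  enters. The function dominates both in the Fubini argument and in the limit of narrow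
  Gaussians.\<close>

lemma integrable_exp_norm_over_cube:
  assumes "0 < c" "4 \<le> CARD('m::finite)"
  shows "integrable lborel (\<lambda>x::real ^ 'm. exp (- c * norm x) / norm x ^ 3)"
proof (rule integrable_radial)
  show "set_integrable lborel {0<..} (\<lambda>r. exp (- c * r) / r ^ 3 * r ^ (DIM(real ^ 'm) - 1))"
  proof (rule set_integrable_cong[THEN iffD1, OF refl refl _ set_integrable_power_exp_neg_real[OF assms(1), of "CARD('m) - 4"]])
    fix r :: real assume "r \<in> {0<..}"
    moreover obtain j where "CARD('m) = j + 4" using assms(2) by (metis le_add_diff_inverse2)
    ultimately show "r ^ (CARD('m) - 4) * exp (- c * r) = exp (- c * r) / r ^ 3 * r ^ (DIM(real ^ 'm) - 1)"
      by (simp add: power_add field_simps eval_nat_numeral)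
  qed
qed (use assms in auto)

lemma borel_measurable_slice_mollified [measurable]:
  "(\<lambda>r. slice_mollified \<gamma> b r y0) \<in> borel_measurable borel"
  unfolding slice_mollified_def slice_kernel_def by measurable

lemma borel_measurable_slice_kernel_radius [measurable]:
  "(\<lambda>r. slice_kernel \<gamma> r y) \<in> borel_measurable borel"
  unfolding slice_kernel_def by measurable

section \<open>From the symbol to a Fourier integral over \<xi>'\<close>

text \<open>Fubini in \<xi>' and \<xi>_n. With the phases removed, the inner integral is again a
  slice integral, now evaluated at 0, so \<open>abs_slice_mollified_le\<close> gives its
  size.\<close>

lemma gaussian_fourier_symbol:
  fixes a' :: "real ^ 'm::finite" and an :: real
  assumes \<gamma>: "0 < \<gamma>" "\<gamma> < pi" and m: "4 \<le> CARD('m)" and b: "0 < b"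
  shows "(LINT \<xi>|lborel. complex_of_real (1 / Q_symbol \<gamma> \<xi>) *
      (complex_of_real (exp (- (norm \<xi>)\<^sup>2 / (4 * b))) * iexp ((a', an) \<bullet> \<xi>))) =
    (LINT \<xi>'|lborel. iexp (a' \<bullet> \<xi>') * complex_of_real (exp (- (norm \<xi>')\<^sup>2 / (4 * b)) * (2 * pi * slice_mollified \<gamma> b (norm \<xi>') an)))"
proof -
  define E where "E s = exp (- s\<^sup>2 / (4 * b))" for s :: real
  define D where "D r \<xi> = r ^ 4 + 2 * cos \<gamma> * r\<^sup>2 * \<xi>\<^sup>2 + \<xi> ^ 4" for r \<xi> :: real
  have E0: "0 < E s" for s by (simp add: E_def)
  have D0: "0 < D r \<xi>" if "0 < r" for r \<xi> unfolding D_def by (rule slice_symbol_pos[OF \<gamma> that])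
  define f where "f \<xi>' \<xi>n = iexp (a' \<bullet> \<xi>') * complex_of_real (E (norm \<xi>')) * (iexp (an * \<xi>n) * complex_of_real (E \<xi>n / D (norm \<xi>') \<xi>n))"
    for \<xi>' :: "real ^ 'm" and \<xi>n
  have [measurable]: "case_prod f \<in> borel_measurable (borel \<Otimes>\<^sub>M borel)"
    unfolding f_def E_def D_def by measurable
  have f_meas: "f \<xi>' \<in> borel_measurable borel" for \<xi>'
    unfolding f_def[abs_def] E_def D_def by measurable
  have f_eq: "complex_of_real (1 / Q_symbol \<gamma> \<xi>) * (complex_of_real (exp (- (norm \<xi>)\<^sup>2 / (4 * b))) * iexp ((a', an) \<bullet> \<xi>)) = case_prod f \<xi>" for \<xi>
  proof -
    obtain \<xi>' \<xi>n where \<xi>: "\<xi> = (\<xi>', \<xi>n)" by (cases \<xi>)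
    have "exp (- (norm \<xi>)\<^sup>2 / (4 * b)) = E (norm \<xi>') * E \<xi>n"
      unfolding E_def exp_add[symmetric] \<xi> by (simp add: norm_Pair diff_divide_distrib)
    moreover have "iexp ((a', an) \<bullet> \<xi>) = iexp (a' \<bullet> \<xi>') * iexp (an * \<xi>n)"
      unfolding exp_add[symmetric] \<xi> by (simp add: algebra_simps)
    ultimately show ?thesis
      unfolding \<xi> by (simp add: f_def Q_symbol_def D_def)
  qed
  have norm_f: "norm (f \<xi>' \<xi>n) = E (norm \<xi>') * (E \<xi>n / D (norm \<xi>') \<xi>n)" if "\<xi>' \<noteq> 0" for \<xi>' \<xi>n
    using E0 D0[of "norm \<xi>'" \<xi>n] that by (simp add: f_def norm_mult norm_divide less_imp_le)
  have slice_int: "integrable lborel (\<lambda>\<xi>n. E \<xi>n / D r \<xi>n)" if "0 < r" for r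
    using slice_symbol_integral(1)[OF \<gamma> that b] by (simp add: E_def D_def)
  have slice_val: "(LINT \<xi>n|lborel. iexp (y * \<xi>n) * complex_of_real (E \<xi>n / D r \<xi>n)) = complex_of_real (2 * pi * slice_mollified \<gamma> b r y)" if "0 < r" for r y
    using slice_symbol_integral(2)[OF \<gamma> that b] by (simp add: E_def D_def)
  have slice_val0: "(LINT \<xi>n|lborel. E \<xi>n / D r \<xi>n) = 2 * pi * slice_mollified \<gamma> b r 0" if "0 < r" for r
  proof -
    have "complex_of_real (LINT \<xi>n|lborel. E \<xi>n / D r \<xi>n) = complex_of_real (2 * pi * slice_mollified \<gamma> b r 0)"
      using slice_val[OF that, of 0] by (simp flip: integral_complex_of_real)
    then show ?thesis by (simp only: of_real_eq_iff)
  qed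
  have AE0: "AE \<xi>' in lborel. \<xi>' \<noteq> (0::real ^ 'm)" by (rule AE_lborel_singleton)
  have f_int: "integrable (lborel \<Otimes>\<^sub>M lborel) (case_prod f)"
  proof (rule lborel_pair.Fubini_integrable)
    let ?B = "\<lambda>\<xi>'::real ^ 'm. exp b * pi / sin \<gamma> * (exp (- 1 * norm \<xi>') / norm \<xi>' ^ 3)"
    show "integrable lborel (\<lambda>\<xi>'. LINT \<xi>n|lborel. norm (case_prod f (\<xi>', \<xi>n)))"
    proof (rule Bochner_Integration.integrable_bound)
      show "integrable lborel ?B"
        using integrable_exp_norm_over_cube[of 1, OF _ m] by (intro integrable_mult_right) simp
      show "AE \<xi>' in lborel. norm (LINT \<xi>n|lborel. norm (case_prod f (\<xi>', \<xi>n))) \<le> norm (?B \<xi>')"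
        using AE0
      proof eventually_elim
        case (elim \<xi>')
        let ?r = "norm \<xi>'"
        have r: "0 < ?r" using elim by simp
        \<comment> \<open>Tangent line at r = 2 b: the Gaussian is at most e^b e^(-r), which reduces
          integrability to \<open>integrable_exp_norm_over_cube\<close> with rate 1.\<close>
        have "0 \<le> (?r - 2 * b)\<^sup>2" by simp
        then have "- ?r\<^sup>2 / (4 * b) \<le> b + - 1 * ?r"
          using b by (simp add: field_simps power2_eq_square)
        then have "E ?r \<le> exp b * exp (- 1 * ?r)"
          unfolding E_def exp_add[symmetric] by simp
        then have "E ?r * (2 * pi * \<bar>slice_mollified \<gamma> b ?r 0\<bar>) \<le> (exp b * exp (- 1 * ?r)) * (2 * pi * (1 / (2 * ?r ^ 3 * sin \<gamma>)))"
          by (intro mult_mono abs_slice_mollified_le[OF \<gamma> r b]) auto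
        also have "\<dots> = ?B \<xi>'" by (simp add: mult_ac)
        also have "\<dots> \<le> norm (?B \<xi>')" unfolding real_norm_def by (rule abs_ge_self)
        also have "E ?r * (2 * pi * \<bar>slice_mollified \<gamma> b ?r 0\<bar>) = norm (LINT \<xi>n|lborel. norm (case_prod f (\<xi>', \<xi>n)))"
        proof -
          have "(LINT \<xi>n|lborel. norm (case_prod f (\<xi>', \<xi>n))) = E ?r * (LINT \<xi>n|lborel. E \<xi>n / D ?r \<xi>n)"
            unfolding prod.case norm_f[OF elim] by (rule integral_mult_right_zero)
          then show ?thesis
            unfolding slice_val0[OF r] by (simp add: abs_mult less_imp_le[OF E0])
        qed
        finally show ?case .
      qed
    qed measurable
    show "AE \<xi>' in lborel. integrable lborel (\<lambda>\<xi>n. case_prod f (\<xi>', \<xi>n))"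
      using AE0
    proof eventually_elim
      case (elim \<xi>')
      have "integrable lborel (\<lambda>\<xi>n. norm (f \<xi>' \<xi>n))"
        unfolding norm_f[OF elim] using elim by (intro integrable_mult_right slice_int) simp
      then show ?case using f_meas by (auto intro: integrable_norm_cancel)
    qed
  qed measurable
  have "(LINT \<xi>|lborel. case_prod f \<xi>) = (LINT \<xi>'|lborel. LINT \<xi>n|lborel. f \<xi>' \<xi>n)"
    using lborel_pair.integral_fst[OF f_int] by (simp add: lborel_prod)
  also have "\<dots> = (LINT \<xi>'|lborel. iexp (a' \<bullet> \<xi>') * complex_of_real (E (norm \<xi>') * (2 * pi * slice_mollified \<gamma> b (norm \<xi>') an)))"
  proof (rule integral_cong_AE)
    show "AE \<xi>' in lborel. (LINT \<xi>n|lborel. f \<xi>' \<xi>n) = iexp (a' \<bullet> \<xi>') * complex_of_real (E (norm \<xi>') * (2 * pi * slice_mollified \<gamma> b (norm \<xi>') an))"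
      using AE0
    proof eventually_elim
      case (elim \<xi>')
      have "(LINT \<xi>n|lborel. f \<xi>' \<xi>n) = iexp (a' \<bullet> \<xi>') * complex_of_real (E (norm \<xi>')) * (LINT \<xi>n|lborel. iexp (an * \<xi>n) * complex_of_real (E \<xi>n / D (norm \<xi>') \<xi>n))"
        unfolding f_def by (rule integral_mult_right_zero)
      then show ?case using slice_val[of "norm \<xi>'" an] elim by simp
    qed
  qed (auto simp: E_def)
  finally show ?thesis unfolding f_eq by (simp add: E_def)
qed

text \<open>The bound \<open>abs_slice_mollified_le_exp\<close> has rate |an| cos (\<gamma>/2). For
  an = 0 the limiting integrand would be a multiple of |\<xi>'|^(-3), not integrable at
  infinity.\<close>

lemma gaussian_fourier_tendsto:
  fixes a' :: "real ^ 'm::finite" and an :: real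
  assumes \<gamma>: "0 < \<gamma>" "\<gamma> < pi" and m: "4 \<le> CARD('m)" and an: "an \<noteq> 0"
  shows "integrable lborel (\<lambda>\<xi>'::real ^ 'm. slice_kernel \<gamma> (norm \<xi>') an)"
    and "(\<lambda>j. LINT \<xi>'|lborel. iexp (a' \<bullet> \<xi>') * complex_of_real (exp (- (norm \<xi>')\<^sup>2 / (4 * real (Suc j))) * (2 * pi * slice_mollified \<gamma> (real (Suc j)) (norm \<xi>') an)))
      \<longlonglongrightarrow> (LINT \<xi>'|lborel. iexp (a' \<bullet> \<xi>') * complex_of_real (2 * pi * slice_kernel \<gamma> (norm \<xi>') an))"
proof -
  note pos = cos_half_pos[OF \<gamma>]
  define c where "c = \<bar>an\<bar> * cos (\<gamma> / 2)"
  have c: "0 < c" using pos an by (simp add: c_def)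
  let ?B = "\<lambda>\<xi>'::real ^ 'm. 2 * pi / sin \<gamma> * (exp (- c * norm \<xi>') / norm \<xi>' ^ 3)"
  have int_B: "integrable lborel ?B"
    using integrable_exp_norm_over_cube[OF c m] by (rule integrable_mult_right)
  have AE0: "AE \<xi>' in lborel. \<xi>' \<noteq> (0::real ^ 'm)" by (rule AE_lborel_singleton)
  show "integrable lborel (\<lambda>\<xi>'::real ^ 'm. slice_kernel \<gamma> (norm \<xi>') an)"
  proof (rule Bochner_Integration.integrable_bound)
    show "integrable lborel (\<lambda>\<xi>'::real ^ 'm. 1 / (2 * sin \<gamma>) * (exp (- c * norm \<xi>') / norm \<xi>' ^ 3))"
      using integrable_exp_norm_over_cube[OF c m] by (rule integrable_mult_right)
    show "AE \<xi>' in lborel. norm (slice_kernel \<gamma> (norm \<xi>') an) \<le> norm (1 / (2 * sin \<gamma>) * (exp (- c * norm (\<xi>'::real ^ 'm)) / norm \<xi>' ^ 3))"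
      using AE0
    proof eventually_elim
      case (elim \<xi>')
      have "\<bar>slice_kernel \<gamma> (norm \<xi>') an\<bar> \<le> 1 / (2 * sin \<gamma>) * (exp (- c * norm \<xi>') / norm \<xi>' ^ 3)"
        using abs_slice_kernel_le[OF \<gamma>, of "norm \<xi>'" an] elim by (simp add: c_def mult_ac)
      then show ?case unfolding real_norm_def by (rule order_trans) (rule abs_ge_self)
    qed
  qed measurable
  show "(\<lambda>j. LINT \<xi>'|lborel. iexp (a' \<bullet> \<xi>') * complex_of_real (exp (- (norm \<xi>')\<^sup>2 / (4 * real (Suc j))) * (2 * pi * slice_mollified \<gamma> (real (Suc j)) (norm \<xi>') an)))
      \<longlonglongrightarrow> (LINT \<xi>'|lborel. iexp (a' \<bullet> \<xi>') * complex_of_real (2 * pi * slice_kernel \<gamma> (norm \<xi>') an))"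
  proof (rule integral_dominated_convergence[where w = ?B])
    show "AE \<xi>' in lborel. (\<lambda>j. iexp (a' \<bullet> \<xi>') * complex_of_real (exp (- (norm \<xi>')\<^sup>2 / (4 * real (Suc j))) * (2 * pi * slice_mollified \<gamma> (real (Suc j)) (norm \<xi>') an)))
       \<longlonglongrightarrow> iexp (a' \<bullet> \<xi>') * complex_of_real (2 * pi * slice_kernel \<gamma> (norm \<xi>') an)"
      using AE0
    proof eventually_elim
      case (elim \<xi>')
      define R where "R = (norm \<xi>')\<^sup>2"
      have "(\<lambda>j. exp (- R / (4 * real (Suc j)))) \<longlonglongrightarrow> 1" by real_asymp
      then have "(\<lambda>j. exp (- R / (4 * real (Suc j))) * (2 * pi * slice_mollified \<gamma> (real (Suc j)) (norm \<xi>') an))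
          \<longlonglongrightarrow> 1 * (2 * pi * slice_kernel \<gamma> (norm \<xi>') an)"
        using elim by (intro tendsto_mult tendsto_const slice_mollified_tendsto[OF \<gamma>]) auto
      then show ?case unfolding R_def mult_1 by (intro tendsto_mult_left tendsto_of_real)
    qed
    show "AE \<xi>' in lborel. norm (iexp (a' \<bullet> \<xi>') * complex_of_real (exp (- (norm \<xi>')\<^sup>2 / (4 * real (Suc j))) * (2 * pi * slice_mollified \<gamma> (real (Suc j)) (norm \<xi>') an))) \<le> ?B \<xi>'" for j
      using AE0
    proof eventually_elim
      case (elim \<xi>')
      let ?M = "slice_mollified \<gamma> (real (Suc j)) (norm \<xi>') an"
      have "exp (- (norm \<xi>')\<^sup>2 / (4 * real (Suc j))) * \<bar>?M\<bar> \<le> exp (- (norm \<xi>' * \<bar>an\<bar> * cos (\<gamma> / 2))) / (norm \<xi>' ^ 3 * sin \<gamma>)"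
        using elim by (intro abs_slice_mollified_le_exp[OF \<gamma>]) auto
      then have "2 * pi * (exp (- (norm \<xi>')\<^sup>2 / (4 * real (Suc j))) * \<bar>?M\<bar>) \<le> 2 * pi * (exp (- (norm \<xi>' * \<bar>an\<bar> * cos (\<gamma> / 2))) / (norm \<xi>' ^ 3 * sin \<gamma>))"
        by (intro mult_left_mono) auto
      moreover have "norm (iexp (a' \<bullet> \<xi>') * complex_of_real (exp (- (norm \<xi>')\<^sup>2 / (4 * real (Suc j))) * (2 * pi * ?M))) =
         2 * pi * (exp (- (norm \<xi>')\<^sup>2 / (4 * real (Suc j))) * \<bar>?M\<bar>)"
        by (simp add: norm_mult abs_mult)
      ultimately show ?case by (simp add: c_def mult_ac)
    qed
  qed (use int_B in measurable)
qed

lemma fundamental_solution_fourier: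
  fixes F :: "'m::finite point \<Rightarrow> complex"
  assumes \<gamma>: "0 < \<gamma>" "\<gamma> < pi" and m: "4 \<le> CARD('m)" and F: "is_fundamental_solution \<gamma> F" and an: "an \<noteq> 0"
  shows "F (a', an) = complex_of_real (1 / (2 * pi) ^ CARD('m)) *
    (LINT \<xi>'|lborel. iexp (a' \<bullet> \<xi>') * complex_of_real (slice_kernel \<gamma> (norm \<xi>') an))"
proof -
  define a where "a = (a', an)"
  define p where "p = (2 * pi) powr (- real DIM('m point) / 2)"
  have schwartz: "schwartz (\<lambda>x. complex_of_real (gaussian b a x))" if "0 < b" for b
    using schwartz_gaussian[OF that, of "(b / pi) powr (DIM('m point) / 2)" a] by (simp add: gaussian_def)
  have "integrable lborel (\<lambda>x. F x * complex_of_real (exp (- (norm (x - a))\<^sup>2)))"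
    using F schwartz_gaussian[of 1 1 a] by (simp add: is_fundamental_solution_def tempered_function_def)
  moreover have "isCont F a"
  proof -
    \<comment> \<open>Continuity off the pole comes from the empty list of derivatives in
      \<open>smooth_on\<close>.\<close>
    have "iter_partial [] F differentiable_on - {0}"
      using F unfolding is_fundamental_solution_def smooth_on_def by (metis empty_set empty_subsetI)
    then have "continuous_on (- {0}) F" by (simp add: differentiable_imp_continuous_on)
    moreover have "a \<in> - {0}" "open (- {0 :: 'm point})" using an by (auto simp: a_def zero_prod_def)
    ultimately show ?thesis using continuous_on_eq_continuous_at by blast
  qed
  ultimately have lim: "(\<lambda>j. LINT x|lborel. F x * complex_of_real (gaussian (real (Suc j)) a x)) \<longlonglongrightarrow> F a"
    by (rule gaussian_approximate_identity)
  have "(LINT x|lborel. F x * complex_of_real (gaussian b a x)) =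
      complex_of_real (p * p) * (LINT \<xi>'|lborel. iexp (a' \<bullet> \<xi>') * complex_of_real (exp (- (norm \<xi>')\<^sup>2 / (4 * b)) * (2 * pi * slice_mollified \<gamma> b (norm \<xi>') an)))"
    if b: "0 < b" for b
  proof -
    have "(LINT x|lborel. F x * complex_of_real (gaussian b a x)) = fund_dist \<gamma> (\<lambda>x. complex_of_real (gaussian b a x))"
      using F schwartz[OF b] by (simp add: is_fundamental_solution_def regular_dist_def)
    also have "\<dots> = complex_of_real p * (LINT \<xi>|lborel. complex_of_real (1 / Q_symbol \<gamma> \<xi>) *
        (complex_of_real (p * exp (- (norm \<xi>)\<^sup>2 / (4 * b))) * iexp (a \<bullet> \<xi>)))"
      unfolding fund_dist_def dist_inv_fourier_def regular_dist_def inv_fourier_gaussian[OF b] p_def ..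
    also have "\<dots> = complex_of_real p * (LINT \<xi>|lborel. complex_of_real p * (complex_of_real (1 / Q_symbol \<gamma> \<xi>) *
        (complex_of_real (exp (- (norm \<xi>)\<^sup>2 / (4 * b))) * iexp (a \<bullet> \<xi>))))"
      by (simp add: mult_ac)
    also have "\<dots> = complex_of_real p * (complex_of_real p * (LINT \<xi>|lborel. (complex_of_real (1 / Q_symbol \<gamma> \<xi>) *
        (complex_of_real (exp (- (norm \<xi>)\<^sup>2 / (4 * b))) * iexp (a \<bullet> \<xi>)))))"
      by (simp only: integral_mult_right_zero)
    finally show ?thesis
      unfolding a_def gaussian_fourier_symbol[OF \<gamma> m b] by simp
  qed
  then have "(\<lambda>j. LINT x|lborel. F x * complex_of_real (gaussian (real (Suc j)) a x)) \<longlonglongrightarrow>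
     complex_of_real (p * p) * (LINT \<xi>'|lborel. iexp (a' \<bullet> \<xi>') * complex_of_real (2 * pi * slice_kernel \<gamma> (norm \<xi>') an))"
    using gaussian_fourier_tendsto(2)[OF \<gamma> m an, of a'] by (simp only: of_nat_0_less_iff zero_less_Suc tendsto_mult_left)
  then have "F a = complex_of_real (p * p) * (LINT \<xi>'|lborel. iexp (a' \<bullet> \<xi>') * complex_of_real (2 * pi * slice_kernel \<gamma> (norm \<xi>') an))"
    by (rule LIMSEQ_unique[OF lim])
  also have "\<dots> = complex_of_real (p * p) * (LINT \<xi>'|lborel. complex_of_real (2 * pi) * (iexp (a' \<bullet> \<xi>') * complex_of_real (slice_kernel \<gamma> (norm \<xi>') an)))"
    by (simp add: mult_ac)
  also have "\<dots> = complex_of_real (p * p) * (complex_of_real (2 * pi) * (LINT \<xi>'|lborel. iexp (a' \<bullet> \<xi>') * complex_of_real (slice_kernel \<gamma> (norm \<xi>') an)))"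
    by (simp only: integral_mult_right_zero)
  also have "\<dots> = complex_of_real (p * p * (2 * pi)) * (LINT \<xi>'|lborel. iexp (a' \<bullet> \<xi>') * complex_of_real (slice_kernel \<gamma> (norm \<xi>') an))"
    by simp
  \<comment> \<open>One factor p = (2 pi)^(-n/2) comes from \<open>fund_dist\<close>, the other from
    \<open>inv_fourier\<close>, and 2 pi from the slice integral; as n = CARD('m) + 1, this leaves
    (2 pi)^(-(n - 1)).\<close>
  also have "p * p * (2 * pi) = 1 / (2 * pi) ^ CARD('m)"
  proof -
    have "p * p = (2 * pi) powr (- real (Suc CARD('m)))"
      unfolding p_def by (simp add: powr_add[symmetric])
    also have "\<dots> = 1 / (2 * pi) ^ Suc CARD('m)"
      unfolding powr_minus_divide by (subst powr_realpow) auto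
    finally show ?thesis by simp
  qed
  finally show ?thesis by (simp only: a_def)
qed

section \<open>Constants and closed forms\<close>

text \<open>The Gamma recursion turns the ball volume into the area of the unit sphere in R^(k + 1);
  \<open>Suc k\<close> keeps the argument of Gamma positive.\<close>

lemma unit_sphere_area:
  "real (Suc k) * unit_ball_vol (real (Suc k)) = 2 * pi powr (real (Suc k) / 2) / Gamma (real (Suc k) / 2)"
proof -
  have "Gamma (real (Suc k) / 2 + 1) = real (Suc k) / 2 * Gamma (real (Suc k) / 2)"
    by (rule Gamma_plus1) (auto elim!: nonpos_Ints_cases)
  then show ?thesis unfolding unit_ball_vol_def by (simp only:) (simp del: of_nat_Suc)
qed

lemma set_integral_Ioi_scale:
  fixes f :: "real \<Rightarrow> real"
  assumes "0 < c"
  shows "(LBINT r:{0<..}. f r) = (LBINT s:{0<..}. f (s / c) / c)"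
proof -
  have "(LBINT r:{0<..}. f r) = \<bar>1 / c\<bar> *\<^sub>R (LINT s|lborel. indicator {0<..} (0 + 1 / c * s) *\<^sub>R f (0 + 1 / c * s))"
    unfolding set_lebesgue_integral_def using assms by (intro lborel_integral_real_affine) simp
  also have "\<dots> = (LINT s|lborel. 1 / c * (indicator {0<..} (0 + 1 / c * s) *\<^sub>R f (0 + 1 / c * s)))"
    using assms by (simp only: integral_mult_right_zero) simp
  also have "\<dots> = (LINT s|lborel. indicator {0<..} s *\<^sub>R (f (s / c) / c))"
    using assms by (intro Bochner_Integration.integral_cong refl) (auto simp: indicator_def zero_less_divide_iff)
  finally show ?thesis by (simp add: set_lebesgue_integral_def)
qed

text \<open>The imaginary part of a Laplace integral with rate w = |y| e^(-i \<gamma>/2): dividing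
  by w^(j + 1) turns the phase by (j + 1) \<gamma>/2, and the phase \<gamma>/2 already in the kernel
  brings it to (j + 2) \<gamma>/2.\<close>

lemma integral_power_slice_kernel:
  assumes \<gamma>: "0 < \<gamma>" "\<gamma> < pi" and y: "y \<noteq> 0"
  shows "(LBINT r:{0<..}. slice_kernel \<gamma> r y * r ^ (j + 3)) =
    fact j / (2 * sin \<gamma> * \<bar>y\<bar> ^ Suc j) * sin ((real j + 2) / 2 * \<gamma>)"
proof -
  note pos = cos_half_pos[OF \<gamma>]
  define w where "w = complex_of_real \<bar>y\<bar> * cis (- (\<gamma> / 2))"
  have w: "0 < Re w" using pos y by (simp add: w_def)
  have Im_cis: "Im (complex_of_real s * cis t) = s * sin t" for s t by simp
  define g where "g r = cis (\<gamma> / 2) / complex_of_real (2 * sin \<gamma>) * (complex_of_real r ^ j * exp (- w * complex_of_real r))" for r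
  have g_int: "set_integrable lborel {0<..} g"
    unfolding g_def[abs_def] using set_integrable_power_exp_neg[OF w] by (rule set_integrable_mult_right)
  have "slice_kernel \<gamma> r y * r ^ (j + 3) = Im (g r)" if "0 < r" for r
  proof -
    have "- w * complex_of_real r = complex_of_real (- (r * \<bar>y\<bar> * cos (\<gamma> / 2))) + \<i> * complex_of_real (r * \<bar>y\<bar> * sin (\<gamma> / 2))"
      by (simp add: w_def complex_eq_iff)
    then have "exp (- w * complex_of_real r) = complex_of_real (exp (- (r * \<bar>y\<bar> * cos (\<gamma> / 2)))) * cis (r * \<bar>y\<bar> * sin (\<gamma> / 2))"
      by (simp only: exp_add exp_of_real cis_conv_exp)
    then have "g r = complex_of_real (r ^ j * exp (- (r * \<bar>y\<bar> * cos (\<gamma> / 2))) / (2 * sin \<gamma>)) * (cis (r * \<bar>y\<bar> * sin (\<gamma> / 2)) * cis (\<gamma> / 2))"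
      by (simp add: g_def mult_ac)
    then have "Im (g r) = r ^ j * exp (- (r * \<bar>y\<bar> * cos (\<gamma> / 2))) / (2 * sin \<gamma>) * sin (r * \<bar>y\<bar> * sin (\<gamma> / 2) + \<gamma> / 2)"
      by (simp only: cis_mult Im_cis)
    then show ?thesis
      using that pos by (simp add: slice_kernel_def power_add)
  qed
  then have "(LBINT r:{0<..}. slice_kernel \<gamma> r y * r ^ (j + 3)) = (LBINT r:{0<..}. Im (g r))"
    by (intro set_lebesgue_integral_cong) auto
  also have "\<dots> = Im (LBINT r:{0<..}. g r)"
    using g_int by (simp add: set_lebesgue_integral_def set_integrable_def flip: integral_Im)
  also have "(LBINT r:{0<..}. g r) = cis (\<gamma> / 2) / complex_of_real (2 * sin \<gamma>) * (fact j / w ^ Suc j)"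
    unfolding g_def set_integral_mult_right integral_power_exp_neg[OF w] ..
  also have "\<dots> = complex_of_real (fact j / (2 * sin \<gamma> * \<bar>y\<bar> ^ Suc j)) * (cis (\<gamma> / 2) / cis (- (\<gamma> / 2)) ^ Suc j)"
    unfolding w_def power_mult_distrib by (simp add: mult_ac)
  also have "cis (\<gamma> / 2) / cis (- (\<gamma> / 2)) ^ Suc j = cis ((real j + 2) / 2 * \<gamma>)"
  proof -
    have "cis (- (\<gamma> / 2)) ^ Suc j = cis (real (Suc j) * - (\<gamma> / 2))" by (rule Complex.DeMoivre)
    moreover have "\<gamma> / 2 - real (Suc j) * - (\<gamma> / 2) = (real j + 2) / 2 * \<gamma>" by (simp add: field_simps)
    ultimately show ?thesis by (simp only: cis_divide)
  qed
  also have "Im (complex_of_real (fact j / (2 * sin \<gamma> * \<bar>y\<bar> ^ Suc j)) * cis ((real j + 2) / 2 * \<gamma>)) =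
    fact j / (2 * sin \<gamma> * \<bar>y\<bar> ^ Suc j) * sin ((real j + 2) / 2 * \<gamma>)"
    by (simp only: Im_cis)
  finally show ?thesis .
qed

theorem proposition3p2:
  fixes n :: nat and \<gamma> :: real and F :: "'m::finite point \<Rightarrow> complex"
  assumes "n = CARD('m) + 1" and "n \<ge> 5"
    and "0 < \<gamma>" and "\<gamma> < pi"
    and "is_fundamental_solution \<gamma> F"
  shows "(\<forall>x' xn. norm x' \<noteq> 0 \<and> xn \<noteq> 0 \<longrightarrow>
      F (x', xn) = complex_of_real
        (1 / (2 ^ (n - 2) * Gamma ((real n - 2) / 2) * pi powr (real n / 2) * norm x' ^ (n - 4)) *
         (LBINT s:{0<..}. C_fun n s *
            (exp (- (\<bar>xn\<bar> / norm x') * s * cos (\<gamma> / 2)) *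
             sin ((\<bar>xn\<bar> / norm x') * s * sin (\<gamma> / 2) + \<gamma> / 2) / (2 * sin \<gamma>)) *
            s ^ (n - 5)))) \<and>
    (\<forall>x' xn. norm x' = 0 \<and> xn \<noteq> 0 \<longrightarrow>
      F (x', xn) = complex_of_real
        (Gamma (real n - 4) /
           (2 ^ (n - 1) * Gamma ((real n - 1) / 2) * pi powr ((real n - 1) / 2) *
            \<bar>xn\<bar> ^ (n - 4) * sin \<gamma>) *
         sin ((real n - 3) / 2 * \<gamma>)))"
proof -
  note \<gamma> = assms(3,4)
  \<comment> \<open>This removes truncated subtraction: n - 4 = Suc j, n - 5 = j and CARD('m) = j +
    4.\<close>
  obtain j where n: "n = j + 5" using assms(2) by (metis le_add_diff_inverse2)
  have card: "CARD('m) = j + 4" using assms(1) n by simp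
  then have card4: "4 \<le> CARD('m)" by simp
  note fourier = fundamental_solution_fourier[OF \<gamma> card4 assms(5)]
  note kernel_int = gaussian_fourier_tendsto(1)[OF \<gamma> card4]
  \<comment> \<open>Sphere area over (2 pi)^(n - 1), shared by both cases: Suc k = n - 2 off the
    axis, where one coordinate is integrated separately, and Suc k = n - 1 on the axis.\<close>
  have sphere: "real (Suc k) * unit_ball_vol (real (Suc k)) / (2 * pi) ^ (j + 4) =
      2 / (2 ^ (j + 4) * Gamma (real (Suc k) / 2) * pi powr (real (j + 4) - real (Suc k) / 2))" for k
  proof -
    have "pi ^ (j + 4) = pi powr (real (Suc k) / 2) * pi powr (real (j + 4) - real (Suc k) / 2)"
      unfolding powr_add[symmetric] by (simp flip: powr_realpow)
    then show ?thesis unfolding unit_sphere_area power_mult_distrib by simp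
  qed
  show ?thesis
  proof (intro conjI allI impI)
    fix x' :: "real ^ 'm" and xn :: real
    assume "norm x' \<noteq> 0 \<and> xn \<noteq> 0"
    then have R: "0 < norm x'" and xn: "xn \<noteq> 0" by auto
    define R where "R = norm x'"
    define H where "H s = C_fun n s * (exp (- (\<bar>xn\<bar> / R) * s * cos (\<gamma> / 2)) *
             sin ((\<bar>xn\<bar> / R) * s * sin (\<gamma> / 2) + \<gamma> / 2) / (2 * sin \<gamma>)) * s ^ (n - 5)" for s
    \<comment> \<open>Scaling s = R r: the power j + 3 against the cube in the kernel leaves (s /
      R)^j, and dr = ds / R, so R^(-(j + 1)) = R^(-(n - 4)) comes out.\<close>
    have "(LBINT r:{0<..}. C_fun (j + 3 + 2) (r * R) * slice_kernel \<gamma> r xn * r ^ (j + 3)) =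
       (LBINT s:{0<..}. C_fun (j + 3 + 2) (s / R * R) * slice_kernel \<gamma> (s / R) xn * (s / R) ^ (j + 3) / R)"
      using R by (intro set_integral_Ioi_scale) (simp add: R_def)
    also have "\<dots> = (LBINT s:{0<..}. 1 / R ^ Suc j * H s)"
    proof (intro set_lebesgue_integral_cong allI impI)
      fix s :: real assume "s \<in> {0<..}"
      then show "C_fun (j + 3 + 2) (s / R * R) * slice_kernel \<gamma> (s / R) xn * (s / R) ^ (j + 3) / R = 1 / R ^ Suc j * H s"
        using R unfolding H_def slice_kernel_def n R_def by (simp add: power_add power_divide mult_ac add.commute[of 5 j])
    qed simp
    also have "\<dots> = 1 / R ^ Suc j * (LBINT s:{0<..}. H s)" by (rule set_integral_mult_right)
    finally have radial: "(LBINT r:{0<..}. C_fun (j + 3 + 2) (r * R) * slice_kernel \<gamma> r xn * r ^ (j + 3)) =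
       1 / R ^ Suc j * (LBINT s:{0<..}. H s)" .
    have "F (x', xn) = complex_of_real (1 / (2 * pi) ^ (j + 4) * (real (j + 3) * unit_ball_vol (real (j + 3)) * (1 / R ^ Suc j * (LBINT s:{0<..}. H s))))"
      unfolding fourier[OF xn] card
      using fourier_radial[of "j + 3" "\<lambda>r. slice_kernel \<gamma> r xn" x', OF _ _ _ kernel_int[OF xn]] card
      unfolding radial[unfolded R_def] by (simp add: R_def borel_measurable_slice_kernel_radius)
    also have "1 / (2 * pi) ^ (j + 4) * (real (j + 3) * unit_ball_vol (real (j + 3)) * (1 / R ^ Suc j * (LBINT s:{0<..}. H s))) =
       real (Suc (j + 2)) * unit_ball_vol (real (Suc (j + 2))) / (2 * pi) ^ (j + 4) / R ^ Suc j * (LBINT s:{0<..}. H s)"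
      by (simp add: numeral_3_eq_3)
    also have "\<dots> = 1 / (2 ^ (n - 2) * Gamma ((real n - 2) / 2) * pi powr (real n / 2) * R ^ (n - 4)) * (LBINT s:{0<..}. H s)"
    proof -
      have e: "real (j + 4) - real (Suc (j + 2)) / 2 = real n / 2" "real (Suc (j + 2)) / 2 = (real n - 2) / 2"
        by (simp_all add: n field_simps)
      show ?thesis unfolding sphere e(1) unfolding e by (simp add: n power_add)
    qed
    finally show "F (x', xn) = complex_of_real
        (1 / (2 ^ (n - 2) * Gamma ((real n - 2) / 2) * pi powr (real n / 2) * norm x' ^ (n - 4)) *
         (LBINT s:{0<..}. C_fun n s *
            (exp (- (\<bar>xn\<bar> / norm x') * s * cos (\<gamma> / 2)) *
             sin ((\<bar>xn\<bar> / norm x') * s * sin (\<gamma> / 2) + \<gamma> / 2) / (2 * sin \<gamma>)) *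
            s ^ (n - 5)))"
      unfolding H_def R_def .
  next
    fix x' :: "real ^ 'm" and xn :: real
    assume "norm x' = 0 \<and> xn \<noteq> 0"
    then have x': "x' = 0" and xn: "xn \<noteq> 0" by auto
    \<comment> \<open>On the axis the plane wave is constantly 1, so the law of the norm alone
      suffices and \<open>C_fun\<close> does not occur.\<close>
    have "(LINT \<xi>'|lborel. slice_kernel \<gamma> (norm (\<xi>' :: real ^ 'm)) xn) =
       real (j + 4) * unit_ball_vol (real (j + 4)) * (LBINT r:{0<..}. slice_kernel \<gamma> r xn * r ^ (j + 3))"
      using integral_radial[of "\<lambda>r. slice_kernel \<gamma> r xn", where 'a = "real ^ 'm"] card
      by (simp add: borel_measurable_slice_kernel_radius add.commute[of 3 j])
    then have "F (x', xn) = complex_of_real (1 / (2 * pi) ^ (j + 4) * (real (j + 4) * unit_ball_vol (real (j + 4)) *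
        (fact j / (2 * sin \<gamma> * \<bar>xn\<bar> ^ Suc j) * sin ((real j + 2) / 2 * \<gamma>))))"
      unfolding fourier[OF xn] card integral_power_slice_kernel[OF \<gamma> xn] x' by simp
    also have "1 / (2 * pi) ^ (j + 4) * (real (j + 4) * unit_ball_vol (real (j + 4)) *
        (fact j / (2 * sin \<gamma> * \<bar>xn\<bar> ^ Suc j) * sin ((real j + 2) / 2 * \<gamma>))) =
       real (Suc (j + 3)) * unit_ball_vol (real (Suc (j + 3))) / (2 * pi) ^ (j + 4) *
        (fact j / (2 * sin \<gamma> * \<bar>xn\<bar> ^ Suc j) * sin ((real j + 2) / 2 * \<gamma>))"
      by (simp add: eval_nat_numeral)
    also have "\<dots> = Gamma (real n - 4) /
           (2 ^ (n - 1) * Gamma ((real n - 1) / 2) * pi powr ((real n - 1) / 2) *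
            \<bar>xn\<bar> ^ (n - 4) * sin \<gamma>) *
         sin ((real n - 3) / 2 * \<gamma>)"
    proof -
      \<comment> \<open>The numerator 2 in \<open>sphere\<close> cancels the 2 of
        \<open>2 * sin \<gamma>\<close>, leaving 2^(n - 1). Off the axis that factor stays inside
        the integral, and the power there is 2^(n - 2).\<close>
      have e: "real (j + 4) - real (Suc (j + 3)) / 2 = (real n - 1) / 2" "real (Suc (j + 3)) / 2 = (real n - 1) / 2"
        "real j + 2 = real n - 3"
        by (simp_all add: n field_simps)
      have "Gamma (real n - 4) = fact j"
        using Gamma_fact[of j, where 'a = real] by (simp add: n add.commute)
      then show ?thesis unfolding sphere e(1) unfolding e by (simp add: n)
    qed
    finally show "F (x', xn) = complex_of_real
        (Gamma (real n - 4) /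
           (2 ^ (n - 1) * Gamma ((real n - 1) / 2) * pi powr ((real n - 1) / 2) *
            \<bar>xn\<bar> ^ (n - 4) * sin \<gamma>) *
         sin ((real n - 3) / 2 * \<gamma>))" .
  qed
qed

end
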